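(* Let $a<b$, $K\ge2$, $\mathcal{I}=\{1,\dots,K\}$, $\mathscr{D}\subseteq D_{cdf}([a,b])$ nonempty and convex, and $\mathsf{T}:D_{cdf}([a,b])\to\mathbb{R}$ with $|\mathsf{T}(F)-\mathsf{T}(G)|\le C\|F-G\|_\infty$ for all $F\in\mathscr{D}$, $G\in D_{cdf}([a,b])$, some $C>0$. Suppose $\mathscr{D}$ contains $H_1,H_2$ with $J_\tau:=\tau H_1+(1-\tau)H_2\in\mathscr{D}$ for all $\tau\in[0,1]$ and $\mathsf{T}(J_{\tau_2})-\mathsf{T}(J_{\tau_1})\ge c_-(\tau_2-\tau_1)$ for all $0\le\tau_1\le\tau_2\le1$, some $c_->0$. Let $\mathscr{M}_K\subseteq\mathscr{S}_K$ be closed with at least two elements. Then there exists $c>0$, independent of $K$, $n$ and $\mathscr{M}_K$, such that for every policy $\pi$ with recommendations in $\mathscr{M}_K$ and every randomization measure $\mathbb{P}_G$, $$\sup_{F^1,\dots,F^K\in\{J_\tau:\tau\in[0,1]\}}\mathbb{E}[r_n(\pi,\mathscr{M}_K)]\ge c\max_{\mathcal{H}}\kappa(\mathcal{H},\mathscr{M}_K)\sqrt{|\mathcal{H}|/n}\quad\text{for every }n\ge K,$$ where the maximum is over all partitions $\mathcal{H}$ of $\{1,\dots,K\}$, $|\mathcal{H}|$ is the number of blocks, and the supremum is over potential outcome distributions with independent marginals having cdfs in $\{J_\tau:\tau\in[0,1]\}$.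
   Context: $D_{cdf}([a,b])$: cdfs with $F(a-)=0$, $F(b)=1$; $\mathscr{S}_K$ unit simplex; $\langle\delta,\mathbf{F}\rangle=\sum_i\delta_iF^i$. For a partition $\mathcal{H}=\{\mathcal{H}_1,\dots,\mathcal{H}_l\}$ of $\{1,\dots,K\}$, $B_i$ is the $K\times|\mathcal{H}_i|$ matrix with columns the standard basis vectors $e_j(K)$, $j\in\mathcal{H}_i$, and $\kappa(\mathcal{H},\mathscr{M}_K)=\sup\{[\max_{\delta\in\mathscr{M}_K}v'\delta-\sup_{\delta\in\mathscr{T}}v'\delta]\wedge\min_{i\le l}[\max_{\delta\in\mathscr{M}_K}(v+B_iw_i)'\delta-\sup_{\delta\in\mathscr{M}_K\setminus\mathscr{T}}(v+B_iw_i)'\delta]\}$ over nonempty Borel $\mathscr{T}\subsetneq\mathscr{M}_K$, $v\in[-1,1]^K$, $w_i\in[-1,1]^{|\mathcal{H}_i|}$. Setting: $Y_t=(Y_{1,t},\dots,Y_{K,t})$ i.i.d. over $t$, $Y_{i,t}\sim F^i$; $G_t$ i.i.d. with law $\mathbb{P}_G$, independent of $(Y_t)$. A policy with recommendations in $\mathscr{M}_K$: for each $n\ge K$, measurable $\pi_{n,t}:([a,b]\times\mathbb{R})^{t-1}\times\mathbb{R}\to\mathcal{I}$ ($t\le n$), $\pi_{n,n+1}:([a,b]\times\mathbb{R})^n\times\mathbb{R}\to\mathscr{M}_K$, with inputs $(Z_0,G_1)=(G_1)$, $Z_{t-1}=(Y_{\pi_{n,t-1}(Z_{t-2},G_{t-1}),t-1},G_{t-1},\dots,Y_{\pi_{n,1}(G_1),1},G_1)$.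 Regret $r_n(\pi,\mathscr{M}_K)=\max_{\delta\in\mathscr{M}_K}\mathsf{T}(\langle\delta,\mathbf{F}\rangle)-\mathsf{T}(\langle\pi_{n,n+1}(Z_n,G_{n+1}),\mathbf{F}\rangle)$. *)

theory Defs
  imports "HOL-Probability.Probability"
begin

definition Dcdf :: "real \<Rightarrow> real \<Rightarrow> (real \<Rightarrow> real) set" where
  "Dcdf a b = {F. mono F \<and> (\<forall>x. continuous (at_right x) F)
      \<and> (F \<longlongrightarrow> 0) at_bot \<and> (F \<longlongrightarrow> 1) at_top
      \<and> (F \<longlongrightarrow> 0) (at_left a) \<and> F b = 1}"

definition supnorm :: "(real \<Rightarrow> real) \<Rightarrow> real" where
  "supnorm f = (SUP x. \<bar>f x\<bar>)"

definition fun_convex :: "(real \<Rightarrow> real) set \<Rightarrow> bool" where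
  "fun_convex S \<longleftrightarrow> (\<forall>F\<in>S. \<forall>G\<in>S. \<forall>t\<in>{0..1}. (\<lambda>x. t * F x + (1 - t) * G x) \<in> S)"

text \<open>Vectors in R^K are functions nat => real, indices 1..K, zero elsewhere.\<close>
definition unit_simplex :: "nat \<Rightarrow> (nat \<Rightarrow> real) set" where
  "unit_simplex K = {\<delta>. (\<forall>i\<in>{1..K}. 0 \<le> \<delta> i) \<and> (\<Sum>i=1..K. \<delta> i) = 1 \<and> (\<forall>i. i \<notin> {1..K} \<longrightarrow> \<delta> i = 0)}"

definition ip :: "nat \<Rightarrow> (nat \<Rightarrow> real) \<Rightarrow> (nat \<Rightarrow> real) \<Rightarrow> real" where
  "ip K v \<delta> = (\<Sum>i=1..K. v i * \<delta> i)"

definition mix :: "nat \<Rightarrow> (nat \<Rightarrow> real) \<Rightarrow> (nat \<Rightarrow> real \<Rightarrow> real) \<Rightarrow> (real \<Rightarrow> real)" where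
  "mix K \<delta> F = (\<lambda>x. \<Sum>i=1..K. \<delta> i * F i x)"

definition embed_block :: "nat set \<Rightarrow> (nat \<Rightarrow> real) \<Rightarrow> (nat \<Rightarrow> real)" where
  "embed_block H w = (\<lambda>j. if j \<in> H then w j else 0)"

text \<open>kappa(H, M_K); P is a partition of {1..K}, w H is the vector w_i for block H.\<close>
definition kappa :: "nat \<Rightarrow> nat set set \<Rightarrow> (nat \<Rightarrow> real) set \<Rightarrow> real" where
  "kappa K P M = (SUP (S, v, w) \<in> {(S, v, w). S \<in> sets (borel :: (nat \<Rightarrow> real) measure) \<and> S \<noteq> {} \<and> S \<subset> M
         \<and> (\<forall>i\<in>{1..K}. \<bar>v i\<bar> \<le> 1) \<and> (\<forall>H\<in>P. \<forall>j\<in>H. \<bar>w H j\<bar> \<le> 1)}.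
      min ((SUP \<delta>\<in>M. ip K v \<delta>) - (SUP \<delta>\<in>S. ip K v \<delta>))
          (Min ((\<lambda>H. (SUP \<delta>\<in>M. ip K (\<lambda>j. v j + embed_block H (w H) j) \<delta>)
                    - (SUP \<delta>\<in>M - S. ip K (\<lambda>j. v j + embed_block H (w H) j) \<delta>)) ` P)))"

text \<open>History Z_k: the map s |-> (Y_{A_s,s}, G_s) on {1..k} (undefined elsewhere),
  where the arm at time t is p t Z_{t-1} G_t.  Y t i is the outcome of arm i at time t.\<close>
primrec hist :: "(nat \<Rightarrow> (nat \<Rightarrow> real \<times> real) \<Rightarrow> real \<Rightarrow> nat) \<Rightarrow> (nat \<Rightarrow> nat \<Rightarrow> real) \<Rightarrow> (nat \<Rightarrow> real)
    \<Rightarrow> nat \<Rightarrow> (nat \<Rightarrow> real \<times> real)" where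
  "hist p Y G 0 = (\<lambda>_. undefined)"
| "hist p Y G (Suc k) = (hist p Y G k)(Suc k := (Y (Suc k) (p (Suc k) (hist p Y G k) (G (Suc k))), G (Suc k)))"

definition is_policy :: "nat \<Rightarrow> (nat \<Rightarrow> real) set \<Rightarrow> nat \<Rightarrow>
    (nat \<Rightarrow> (nat \<Rightarrow> real \<times> real) \<Rightarrow> real \<Rightarrow> nat) \<Rightarrow> ((nat \<Rightarrow> real \<times> real) \<Rightarrow> real \<Rightarrow> (nat \<Rightarrow> real)) \<Rightarrow> bool" where
  "is_policy K M n p r \<longleftrightarrow>
     (\<forall>t\<in>{1..n}. (\<lambda>(h, g). p t h g) \<in> (PiM {1..t-1} (\<lambda>_. borel) \<Otimes>\<^sub>M borel) \<rightarrow>\<^sub>M count_space {1..K})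
   \<and> (\<lambda>(h, g). r h g) \<in> (PiM {1..n} (\<lambda>_. borel) \<Otimes>\<^sub>M borel) \<rightarrow>\<^sub>M restrict_space borel M"

definition sample_space :: "nat \<Rightarrow> (nat \<Rightarrow> real \<Rightarrow> real) \<Rightarrow> real measure \<Rightarrow> nat
    \<Rightarrow> ((nat \<Rightarrow> nat \<Rightarrow> real) \<times> (nat \<Rightarrow> real)) measure" where
  "sample_space K F PG n = (PiM {1..n} (\<lambda>t. PiM {1..K} (\<lambda>i. interval_measure (F i)))) \<Otimes>\<^sub>M (PiM {1..Suc n} (\<lambda>_. PG))"

definition exp_regret :: "((real \<Rightarrow> real) \<Rightarrow> real) \<Rightarrow> nat \<Rightarrow> (nat \<Rightarrow> real) set \<Rightarrow> (nat \<Rightarrow> real \<Rightarrow> real)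
    \<Rightarrow> real measure \<Rightarrow> nat \<Rightarrow> (nat \<Rightarrow> (nat \<Rightarrow> real \<times> real) \<Rightarrow> real \<Rightarrow> nat)
    \<Rightarrow> ((nat \<Rightarrow> real \<times> real) \<Rightarrow> real \<Rightarrow> (nat \<Rightarrow> real)) \<Rightarrow> real" where
  "exp_regret T K M F PG n p r =
     (\<integral>\<omega>. (SUP \<delta>\<in>M. T (mix K \<delta> F)) - T (mix K (r (hist p (fst \<omega>) (snd \<omega>) n) (snd \<omega> (Suc n))) F)
        \<partial>sample_space K F PG n)"

end

(*
  Fix a partition into l blocks and a triple (S, v, w) nearly attaining kappa, and put
  e = sqrt (l / n) / 16. In the base environment arm i has cdf J_tau with tau = 1/2 + e v_i; for a
  block H the alternative environment shifts tau by e w_i on the arms of H only. Since T grows at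
  rate at least cm along the path J, a recommendation in S costs at least cm e kappa in the base
  environment, and one outside S costs at least that much in every alternative environment. Some
  block is sampled at most n / l times on average in the base environment, so for this block the
  divergence between the two laws of the history is at most 18 e^2 n / l < 1/4 and no test separates
  them: the probabilities of the two costly events add up to at least 1/2.
*)
theory Submission
  imports Defs
begin

text \<open>Arms are chosen adaptively, so the law of the history is not a product measure: the
  model draws a full table of outcomes, and \<open>hist\<close> reads one cell per round. The law is
  therefore handled through its one-step transition, and two environments are compared by induction
  on the rounds. They differ only in the outcome laws, so the likelihood ratio is a product of
  densities along the history, and Wald's identity reduces its expected logarithm to pulls of the
  block times the divergence of one pull.

  Origin of 18: the base weights tau and 1 - tau are at least 1/3, so a shift of at most e changes
  each by a factor between 1 - 3e and 1 + 3e, and a density in this range has divergence at most 2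
  (3e)^2. With n/l pulls the choice of e gives 18/256.

  The block is selected by how the policy behaves in the base environment, whence the minimum over
  all blocks in kappa.

  Divergences appear as integrals of 1 - ln rho, which is nonnegative here, so the estimate stays
  within nonnegative integrals.\<close>

declare One_nat_def [simp del]

section \<open>Mixtures and densities\<close>

lemma Dcdf_real_distribution:
  assumes "F \<in> Dcdf a b"
  shows "real_distribution (interval_measure F)" "cdf (interval_measure F) = F"
  using assms
  by (auto intro!: real_distribution_interval_measure cdf_interval_measure simp: Dcdf_def mono_def)

text \<open>A probability measure on the line is determined by its cdf, so it is enough to build the
  mixture of the two measures by hand and to compute its cdf. Mixtures of measures can be compared
  on every Borel set, which is what the existence of a bounded density needs.\<close>

lemma emeasure_interval_measure_mixture:
  assumes F: "F \<in> Dcdf a b" and G: "G \<in> Dcdf a b"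
    and FG: "(\<lambda>x. t * F x + (1 - t) * G x) \<in> Dcdf a b"
    and t: "0 \<le> t" "t \<le> 1" and A: "A \<in> sets borel"
  shows "emeasure (interval_measure (\<lambda>x. t * F x + (1 - t) * G x)) A
    = ennreal t * emeasure (interval_measure F) A + ennreal (1 - t) * emeasure (interval_measure G) A"
proof -
  define \<mu> where "\<mu> A = ennreal t * emeasure (interval_measure F) A
    + ennreal (1 - t) * emeasure (interval_measure G) A" for A
  define N where "N = measure_of UNIV (sets borel) \<mu>"
  interpret F: real_distribution "interval_measure F" by (rule Dcdf_real_distribution(1)[OF F])
  interpret G: real_distribution "interval_measure G" by (rule Dcdf_real_distribution(1)[OF G])
  have sa: "sigma_algebra UNIV (sets (borel :: real measure))"
    by (metis sets.sigma_algebra_axioms space_borel)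
  have N: "emeasure N A = \<mu> A" if "A \<in> sets borel" for A
    unfolding N_def
  proof (rule emeasure_measure_of_sigma[OF sa _ _ that])
    show "positive (sets borel) \<mu>" by (simp add: positive_def \<mu>_def)
    show "countably_additive (sets borel) \<mu>"
      unfolding countably_additive_def
    proof (intro allI impI)
      fix B :: "nat \<Rightarrow> real set"
      assume "range B \<subseteq> sets borel" "disjoint_family B" "\<Union> (range B) \<in> sets borel"
      then have "(\<Sum>i. emeasure (interval_measure F) (B i)) = emeasure (interval_measure F) (\<Union> (range B))"
        "(\<Sum>i. emeasure (interval_measure G) (B i)) = emeasure (interval_measure G) (\<Union> (range B))"
        by (auto intro!: suminf_emeasure)
      then show "(\<Sum>i. \<mu> (B i)) = \<mu> (\<Union> (range B))"
        unfolding \<mu>_def by (subst suminf_add[symmetric]) auto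
    qed
  qed
  have space_N: "space N = UNIV" and sets_N: "sets N = sets borel"
    using sa by (simp_all add: N_def sigma_algebra.sigma_sets_eq)
  have "\<mu> UNIV = 1"
    using F.emeasure_space_1 G.emeasure_space_1 t
    by (simp add: \<mu>_def flip: ennreal_plus)
  then interpret N: prob_space N
    by (intro prob_spaceI) (simp add: space_N N)
  interpret N: real_distribution N
    by unfold_locales (auto simp: space_N sets_N)
  interpret J: real_distribution "interval_measure (\<lambda>x. t * F x + (1 - t) * G x)"
    by (rule Dcdf_real_distribution(1)[OF FG])
  have "cdf N x = t * F x + (1 - t) * G x" for x
  proof -
    have *: "measure (interval_measure F) {..x} = F x" "measure (interval_measure G) {..x} = G x"
      using Dcdf_real_distribution(2)[OF F] Dcdf_real_distribution(2)[OF G] by (metis cdf_def)+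
    have F0: "0 \<le> F x" "0 \<le> G x" using * by (metis measure_nonneg)+
    have "emeasure N {..x} = ennreal (t * F x + (1 - t) * G x)"
      using t F0 by (simp add: N \<mu>_def F.emeasure_eq_measure G.emeasure_eq_measure * ennreal_mult'')
    then show ?thesis using t F0 by (simp add: cdf_def measure_def del: ennreal_plus)
  qed
  then have "N = interval_measure (\<lambda>x. t * F x + (1 - t) * G x)"
    using Dcdf_real_distribution(2)[OF FG] by (intro cdf_unique N.real_distribution_axioms J.real_distribution_axioms) auto
  with N[OF A] show ?thesis by (simp add: \<mu>_def)
qed

text \<open>The Radon-Nikodym derivative obeys the bounds almost everywhere; it is replaced by a
  version that obeys them at every point. Pointwise bounds are wanted because the densities are
  later multiplied, and their logarithms taken, along arbitrary histories.\<close>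

lemma ex_density_between:
  assumes "finite_measure M" "finite_measure N" and sets: "sets N = sets M" and lu: "0 \<le> l" "l \<le> u"
    and lower: "\<And>A. A \<in> sets M \<Longrightarrow> ennreal l * emeasure M A \<le> emeasure N A"
    and upper: "\<And>A. A \<in> sets M \<Longrightarrow> emeasure N A \<le> ennreal u * emeasure M A"
  obtains \<rho> :: "'a \<Rightarrow> real" where "\<rho> \<in> borel_measurable M" "\<And>x. l \<le> \<rho> x" "\<And>x. \<rho> x \<le> u"
    "N = density M (\<lambda>x. ennreal (\<rho> x))"
proof -
  interpret M: finite_measure M by fact
  interpret N: finite_measure N by fact
  have "absolutely_continuous M N"
    unfolding absolutely_continuous_def
  proof
    fix A assume "A \<in> null_sets M"
    then show "A \<in> null_sets N" using upper[of A] sets by (auto simp: null_sets_def)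
  qed
  then obtain f where f[measurable]: "f \<in> borel_measurable M" and N: "density M f = N"
    using M.Radon_Nikodym[OF _ sets] by blast
  have up: "AE x in M. f x \<le> ennreal u"
  proof -
    \<comment> \<open>With the slack \<open>1 / Suc m\<close>, the two bounds for the mass of the
      exceptional set \<open>A\<close> are compatible only if \<open>A\<close> is null. The slack
      tends to 0 afterwards.\<close>
    have "AE x in M. f x \<le> ennreal (u + 1 / Suc m)" for m :: nat
    proof -
      let ?c = "u + 1 / Suc m"
      define A where "A = {x\<in>space M. ennreal ?c < f x}"
      have A[measurable]: "A \<in> sets M" by (simp add: A_def)
      have "ennreal ?c * emeasure M A \<le> emeasure N A"
      proof -
        have "ennreal ?c * emeasure M A = (\<integral>\<^sup>+x. ennreal ?c * indicator A x \<partial>M)"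
          by (simp add: nn_integral_cmult_indicator)
        also have "\<dots> \<le> (\<integral>\<^sup>+x. f x * indicator A x \<partial>M)"
          by (intro nn_integral_mono) (auto simp: A_def split: split_indicator)
        also have "\<dots> = emeasure N A" by (simp add: N[symmetric] emeasure_density)
        finally show ?thesis .
      qed
      also have "\<dots> \<le> ennreal u * emeasure M A" by (rule upper[OF A])
      finally have "ennreal (?c * measure M A) \<le> ennreal (u * measure M A)"
        using lu by (simp add: M.emeasure_eq_measure ennreal_mult'')
      then have "?c * measure M A \<le> u * measure M A"
        using lu by (subst (asm) ennreal_le_iff) auto
      then have "measure M A = 0"
        using measure_nonneg[of M A] by (simp add: field_simps)
      then have "A \<in> null_sets M" by (simp add: M.emeasure_eq_measure null_sets_def)
      then show ?thesis by (rule AE_I') (auto simp: A_def)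
    qed
    then have "AE x in M. \<forall>m::nat. f x \<le> ennreal (u + 1 / Suc m)" by (simp add: AE_all_countable)
    then show ?thesis
    proof (rule AE_mp, intro AE_I2 impI)
      fix x assume *: "\<forall>m::nat. f x \<le> ennreal (u + 1 / Suc m)"
      have "(\<lambda>m. u + 1 / Suc m) \<longlonglongrightarrow> u + 0"
        by (intro tendsto_add tendsto_const lim_1_over_n[THEN filterlim_sequentially_Suc[THEN iffD2]])
      then have "(\<lambda>m. ennreal (u + 1 / Suc m)) \<longlonglongrightarrow> ennreal u" by (simp add: tendsto_ennrealI)
      then show "f x \<le> ennreal u" by (rule LIMSEQ_le_const) (use * in auto)
    qed
  qed
  have lo: "AE x in M. ennreal l \<le> f x"
  proof -
    have "AE x in M. ennreal (l - 1 / Suc m) \<le> f x" for m :: nat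
    proof (cases "l - 1 / Suc m \<ge> 0")
      \<comment> \<open>\<open>ennreal\<close> turns a negative bound into 0.\<close>
      case False then show ?thesis by (simp add: ennreal_neg)
    next
      case True
      let ?c = "l - 1 / Suc m"
      define A where "A = {x\<in>space M. f x < ennreal ?c}"
      have A[measurable]: "A \<in> sets M" by (simp add: A_def)
      have "ennreal l * emeasure M A \<le> emeasure N A" by (rule lower[OF A])
      also have "emeasure N A \<le> ennreal ?c * emeasure M A"
      proof -
        have "emeasure N A = (\<integral>\<^sup>+x. f x * indicator A x \<partial>M)" by (simp add: N[symmetric] emeasure_density)
        also have "\<dots> \<le> (\<integral>\<^sup>+x. ennreal ?c * indicator A x \<partial>M)"
          by (intro nn_integral_mono) (auto simp: A_def split: split_indicator)
        also have "\<dots> = ennreal ?c * emeasure M A"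
          by (simp add: nn_integral_cmult_indicator)
        finally show ?thesis .
      qed
      finally have "ennreal (l * measure M A) \<le> ennreal (?c * measure M A)"
        using lu True by (simp add: M.emeasure_eq_measure ennreal_mult'')
      then have "l * measure M A \<le> ?c * measure M A"
        using True by (subst (asm) ennreal_le_iff) auto
      then have "measure M A = 0"
        using measure_nonneg[of M A] by (simp add: field_simps)
      then have "A \<in> null_sets M" by (simp add: M.emeasure_eq_measure null_sets_def)
      then show ?thesis by (rule AE_I') (auto simp: A_def)
    qed
    then have "AE x in M. \<forall>m::nat. ennreal (l - 1 / Suc m) \<le> f x" by (simp add: AE_all_countable)
    then show ?thesis
    proof (rule AE_mp, intro AE_I2 impI)
      fix x assume *: "\<forall>m::nat. ennreal (l - 1 / Suc m) \<le> f x"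
      have "(\<lambda>m. l - 1 / Suc m) \<longlonglongrightarrow> l - 0"
        by (intro tendsto_diff tendsto_const lim_1_over_n[THEN filterlim_sequentially_Suc[THEN iffD2]])
      then have "(\<lambda>m. ennreal (l - 1 / Suc m)) \<longlonglongrightarrow> ennreal l" by (simp add: tendsto_ennrealI)
      then show "ennreal l \<le> f x" by (rule LIMSEQ_le_const2) (use * in auto)
    qed
  qed
  \<comment> \<open>Clamping to the interval from \<open>l\<close> to \<open>u\<close> alters
    \<open>f\<close> only on a null set, by \<open>up\<close> and \<open>lo\<close>.\<close>
  define \<rho> where "\<rho> = (\<lambda>x. min u (max l (enn2real (f x))))"
  have [measurable]: "\<rho> \<in> borel_measurable M" by (simp add: \<rho>_def)
  have "N = density M (\<lambda>x. ennreal (\<rho> x))"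
    unfolding N[symmetric]
  proof (rule density_cong)
    show "AE x in M. f x = ennreal (\<rho> x)"
      using up lo
    proof eventually_elim
      case (elim x)
      then have fin: "f x < \<top>" by (metis ennreal_less_top order_le_less_trans)
      then have "ennreal (enn2real (f x)) = f x" by simp
      moreover from this have "enn2real (f x) \<le> u" "l \<le> enn2real (f x)"
        using elim lu by (metis ennreal_le_iff order_trans, metis enn2real_nonneg ennreal_le_iff)
      ultimately show ?case by (simp add: \<rho>_def)
    qed
  qed auto
  then show thesis using lu by (intro that[of \<rho>]) (auto simp: \<rho>_def)
qed

section \<open>The law of the history\<close>

locale bandit =
  fixes K n :: nat and p :: "nat \<Rightarrow> (nat \<Rightarrow> real \<times> real) \<Rightarrow> real \<Rightarrow> nat" and PG :: "real measure"
  assumes p_measurable: "t \<in> {1..n} \<Longrightarrow>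
      (\<lambda>(h, g). p t h g) \<in> PiM {1..t-1} (\<lambda>_. borel) \<Otimes>\<^sub>M borel \<rightarrow>\<^sub>M count_space {1..K}"
    and PG: "prob_space PG" and sets_PG[measurable_cong]: "sets PG = sets borel"
begin

abbreviation outcomes :: "(nat \<Rightarrow> real measure) \<Rightarrow> (nat \<Rightarrow> real) measure" where
  "outcomes \<nu> \<equiv> PiM {1..K} \<nu>"

abbreviation histories :: "nat \<Rightarrow> (nat \<Rightarrow> real \<times> real) measure" where
  "histories k \<equiv> PiM {1..k} (\<lambda>_. borel)"

lemma p_measurable'[measurable (raw)]:
  assumes "Suc k \<le> n" "f \<in> M \<rightarrow>\<^sub>M histories k" "g \<in> borel_measurable M"
  shows "(\<lambda>x. p (Suc k) (f x) (g x)) \<in> M \<rightarrow>\<^sub>M count_space {1..K}"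
  using measurable_compose[OF measurable_Pair[OF assms(2,3)], of "\<lambda>(h, g). p (Suc k) h g"]
    p_measurable[of "Suc k"] assms(1) by simp

lemma p_range: "Suc k \<le> n \<Longrightarrow> h \<in> space (histories k) \<Longrightarrow> p (Suc k) h g \<in> {1..K}"
  using measurable_space[OF p_measurable[of "Suc k"], of "(h, g)"] by (auto simp: space_pair_measure)

lemma history_upd_measurable[measurable (raw)]:
  assumes "f \<in> M \<rightarrow>\<^sub>M histories k" "a \<in> borel_measurable M" "b \<in> borel_measurable M"
  shows "(\<lambda>x. (f x)(Suc k := (a x, b x))) \<in> M \<rightarrow>\<^sub>M histories (Suc k)"
  using assms by (intro measurable_fun_upd[where J="{1..k}"]) (auto simp: borel_prod[symmetric])

text \<open>A history stores outcomes and randomizations but not the arms. The arm of round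
  \<open>t\<close> is recomputed from the earlier entries and the randomization
  \<open>snd (h t)\<close>; \<open>restrict\<close> resets the other entries to
  \<open>undefined\<close>, as \<open>hist\<close> does.\<close>

definition act :: "nat \<Rightarrow> (nat \<Rightarrow> real \<times> real) \<Rightarrow> nat" where
  "act t h = p t (restrict h {1..t-1}) (snd (h t))"

lemma act_measurable[measurable (raw)]:
  assumes "t \<in> {1..k}" "k \<le> n"
  shows "act t \<in> histories k \<rightarrow>\<^sub>M count_space {1..K}"
proof -
  obtain s where t: "t = Suc s" using assms by (cases t) auto
  have "(\<lambda>h. h t) \<in> histories k \<rightarrow>\<^sub>M borel"
    using assms(1) by (rule measurable_component_singleton)
  then have *: "(\<lambda>h. h t) \<in> histories k \<rightarrow>\<^sub>M borel \<Otimes>\<^sub>M borel"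
    by (simp add: borel_prod)
  have "(\<lambda>h. p (Suc s) (restrict h {1..s}) (snd (h t))) \<in> histories k \<rightarrow>\<^sub>M count_space {1..K}"
    using assms t by (intro p_measurable' measurable_restrict_subset measurable_compose[OF * measurable_snd]) auto
  then show ?thesis by (simp add: act_def[abs_def] t)
qed

lemma act_upd: "t \<in> {1..k} \<Longrightarrow> act t (h(Suc k := z)) = act t h"
  unfolding act_def by (intro arg_cong2[where f="p t"]) (auto simp: restrict_def fun_eq_iff)

lemma act_upd_last:
  assumes "h \<in> space (histories k)"
  shows "act (Suc k) (h(Suc k := (y, g))) = p (Suc k) h g"
proof -
  have "restrict (h(Suc k := (y, g))) {1..k} = h"
    using assms by (auto simp: space_PiM PiE_def extensional_def restrict_def fun_eq_iff)
  then show ?thesis by (simp add: act_def)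
qed

lemma reward_measurable[measurable (raw)]:
  assumes "t \<in> {1..k}"
  shows "(\<lambda>h. fst (h t)) \<in> borel_measurable (histories k)"
proof -
  have "(\<lambda>h. h t) \<in> histories k \<rightarrow>\<^sub>M borel"
    using assms by (rule measurable_component_singleton)
  then have "(\<lambda>h. h t) \<in> histories k \<rightarrow>\<^sub>M borel \<Otimes>\<^sub>M borel"
    by (simp add: borel_prod)
  from measurable_compose[OF this measurable_fst] show ?thesis .
qed

text \<open>The arm is random but takes countably many values, so measurability of \<open>c\<close>
  for each fixed arm suffices.\<close>

lemma act_reward_measurable[measurable (raw)]:
  fixes c :: "nat \<Rightarrow> real \<Rightarrow> 'b :: topological_space"
  assumes "t \<in> {1..k}" "k \<le> n" and c: "\<And>i. c i \<in> borel_measurable borel"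
  shows "(\<lambda>h. c (act t h) (fst (h t))) \<in> borel_measurable (histories k)"
  by (rule measurable_compose_countable'[OF _ act_measurable[OF assms(1,2)]])
    (auto intro: measurable_compose[OF reward_measurable[OF assms(1)] c])

text \<open>The index sets are left open because the same history is needed on larger product
  spaces, notably with the additional randomization of the next round. The table is read at a random
  arm, which is again treated arm by arm.\<close>

lemma hist_measurable:
  assumes "k \<le> n" "{1..k} \<subseteq> I" "{1..k} \<subseteq> J" "\<And>i. i \<in> {1..K} \<Longrightarrow> sets (\<nu> i) = sets borel"
  shows "(\<lambda>(Y, G). hist p Y G k) \<in> PiM I (\<lambda>_. outcomes \<nu>) \<Otimes>\<^sub>M PiM J (\<lambda>_. PG) \<rightarrow>\<^sub>M histories k"
  using assms(1-3)
proof (induction k)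
  case 0
  show ?case by (simp add: PiM_empty split_beta')
next
  case (Suc k)
  let ?M = "PiM I (\<lambda>_. outcomes \<nu>) \<Otimes>\<^sub>M PiM J (\<lambda>_. PG)"
  have h[measurable]: "(\<lambda>x. hist p (fst x) (snd x) k) \<in> ?M \<rightarrow>\<^sub>M histories k"
  proof -
    have "{1..k} \<subseteq> {1..Suc k}" by simp
    then have "{1..k} \<subseteq> I" "{1..k} \<subseteq> J" "k \<le> n" using Suc.prems by (blast, blast, simp)
    from Suc.IH[OF this(3,1,2)] show ?thesis by (simp only: split_beta')
  qed
  have k: "Suc k \<in> I" "Suc k \<in> J" "Suc k \<le> n" using Suc.prems by auto
  have g: "(\<lambda>x. snd x (Suc k)) \<in> ?M \<rightarrow>\<^sub>M PG"
    using k by measurable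
  then have g'[measurable]: "(\<lambda>x. snd x (Suc k)) \<in> borel_measurable ?M"
    using sets_PG measurable_cong_sets by blast
  have a: "(\<lambda>x. p (Suc k) (hist p (fst x) (snd x) k) (snd x (Suc k))) \<in> ?M \<rightarrow>\<^sub>M count_space {1..K}"
    using k by measurable
  have "(\<lambda>x. fst x (Suc k) i) \<in> borel_measurable ?M" if "i \<in> {1..K}" for i
  proof -
    have "(\<lambda>x. fst x (Suc k) i) \<in> ?M \<rightarrow>\<^sub>M \<nu> i"
      by (rule measurable_compose[OF measurable_compose[OF measurable_fst measurable_component_singleton[OF k(1)]]
            measurable_component_singleton[OF that]])
    then show ?thesis using assms(4)[OF that] measurable_cong_sets by blast
  qed
  from measurable_compose_countable'[OF this a]
  have "(\<lambda>x. fst x (Suc k) (p (Suc k) (hist p (fst x) (snd x) k) (snd x (Suc k)))) \<in> borel_measurable ?M"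
    by simp
  then have "(\<lambda>x. (hist p (fst x) (snd x) k)(Suc k :=
      (fst x (Suc k) (p (Suc k) (hist p (fst x) (snd x) k) (snd x (Suc k))), snd x (Suc k)))) \<in> ?M \<rightarrow>\<^sub>M histories (Suc k)"
    by (intro measurable_fun_upd[where J="{1..k}"] h) (auto simp: borel_prod[symmetric])
  then show ?case by (simp only: split_beta' hist.simps)
qed

end

section \<open>The law of the history in one environment and its one-step transition\<close>

locale bandit_environment = bandit +
  fixes \<nu> :: "nat \<Rightarrow> real measure"
  assumes prob_\<nu>: "prob_space (\<nu> i)" and sets_\<nu>[measurable_cong]: "sets (\<nu> i) = sets borel"
begin

lemma prob_space_outcomes: "prob_space (outcomes \<nu>)"
  by (rule prob_space_PiM) (rule prob_\<nu>)

lemma prob_space_PiM_outcomes: "prob_space (PiM I (\<lambda>_. outcomes \<nu>))"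
  by (rule prob_space_PiM) (rule prob_space_outcomes)

lemma prob_space_PiM_PG: "prob_space (PiM I (\<lambda>_. PG))"
  by (rule prob_space_PiM) (rule PG)

sublocale Ys: product_sigma_finite "\<lambda>_. outcomes \<nu>"
  by (simp add: product_sigma_finite_def prob_space_outcomes prob_space_imp_sigma_finite)

sublocale Gs: product_sigma_finite "\<lambda>_. PG"
  by (simp add: product_sigma_finite_def PG prob_space_imp_sigma_finite)

text \<open>Only \<open>k\<close> rounds of the table are drawn, whatever the horizon
  \<open>n\<close>, so that \<open>law (Suc k)\<close> can be expressed through
  \<open>law k\<close>.\<close>

definition law :: "nat \<Rightarrow> (nat \<Rightarrow> real \<times> real) measure" where
  "law k = distr (PiM {1..k} (\<lambda>_. outcomes \<nu>) \<Otimes>\<^sub>M PiM {1..k} (\<lambda>_. PG)) (histories k) (\<lambda>(Y, G). hist p Y G k)"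

lemma sets_law[simp, measurable_cong]: "sets (law k) = sets (histories k)"
  by (simp add: law_def)

lemma space_law[simp]: "space (law k) = space (histories k)"
  by (simp add: law_def)

text \<open>Changing coordinate \<open>Suc k\<close> of the table leaves the history after
  \<open>k\<close> rounds alone; this is how independence of past and next round enters.\<close>

lemma hist_cong:
  "\<forall>t\<in>{1..k}. Y t = Y' t \<and> G t = G' t \<Longrightarrow> hist p Y G k = hist p Y' G' k"
  by (induction k) auto

lemma act_measurable_law: "t \<in> {1..n} \<Longrightarrow> act t \<in> law n \<rightarrow>\<^sub>M count_space {1..K}"
  using act_measurable[of t n] by simp

lemma act_range: "h \<in> space (law n) \<Longrightarrow> t \<in> {1..n} \<Longrightarrow> act t h \<in> {1..K}"
  using measurable_space[OF act_measurable_law, of t h] by simp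

lemma indicator_act_measurable:
  "t \<in> {1..n} \<Longrightarrow> (\<lambda>h. indicator H (act t h) :: ennreal) \<in> borel_measurable (law n)"
  by (rule measurable_compose[OF act_measurable_law]) simp_all

lemma prob_space_law: "k \<le> n \<Longrightarrow> prob_space (law k)"
  unfolding law_def
  by (intro prob_space.prob_space_distr prob_space_pair prob_space_PiM_outcomes prob_space_PiM_PG hist_measurable) (auto simp: sets_\<nu>)

text \<open>The next randomization is independent of the history so far. For \<open>k < n\<close> it
  serves to select the next arm, for \<open>k = n\<close> the recommendation.\<close>

lemma nn_integral_hist_randomization:
  assumes k: "k \<le> n" and \<Phi>[measurable]: "\<Phi> \<in> borel_measurable (histories k \<Otimes>\<^sub>M borel)"
  shows "(\<integral>\<^sup>+\<omega>. \<Phi> (hist p (fst \<omega>) (snd \<omega>) k, snd \<omega> (Suc k)) \<partial>(PiM {1..k} (\<lambda>_. outcomes \<nu>) \<Otimes>\<^sub>M PiM {1..Suc k} (\<lambda>_. PG)))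
    = (\<integral>\<^sup>+h. \<integral>\<^sup>+g. \<Phi> (h, g) \<partial>PG \<partial>law k)"
proof -
  let ?Y = "PiM {1..k} (\<lambda>_. outcomes \<nu>)" and ?G = "\<lambda>k. PiM {1..k::nat} (\<lambda>_. PG)"
  have hm[measurable]: "(\<lambda>x. hist p (fst x) (snd x) k) \<in> ?Y \<Otimes>\<^sub>M ?G k \<rightarrow>\<^sub>M histories k"
    "(\<lambda>x. hist p (fst x) (snd x) k) \<in> ?Y \<Otimes>\<^sub>M ?G (Suc k) \<rightarrow>\<^sub>M histories k"
    using hist_measurable[of k "{1..k}" "{1..k}" \<nu>] hist_measurable[of k "{1..k}" "{1..Suc k}" \<nu>] k
    by (auto simp: split_beta' sets_\<nu>)
  have hm'[measurable (raw)]: "(\<lambda>x. hist p (f x) (g x) k) \<in> M \<rightarrow>\<^sub>M histories k"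
    if "f \<in> M \<rightarrow>\<^sub>M ?Y" "g \<in> M \<rightarrow>\<^sub>M ?G k" for f g and M :: "'z measure"
    using measurable_compose[OF measurable_Pair[OF that] hm(1)] by simp
  have hm''[measurable (raw)]: "(\<lambda>x. hist p (f x) (g x) k) \<in> M \<rightarrow>\<^sub>M histories k"
    if "f \<in> M \<rightarrow>\<^sub>M ?Y" "g \<in> M \<rightarrow>\<^sub>M ?G (Suc k)" for f g and M :: "'z measure"
    using measurable_compose[OF measurable_Pair[OF that] hm(2)] by simp
  have sm'[measurable (raw)]: "(\<lambda>x. g x (Suc k)) \<in> borel_measurable M"
    if "g \<in> M \<rightarrow>\<^sub>M ?G (Suc k)" for g and M :: "'z measure"
  proof -
    have "(\<lambda>x. g x (Suc k)) \<in> M \<rightarrow>\<^sub>M PG" using that by measurable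
    then show ?thesis using sets_PG measurable_cong_sets by blast
  qed
  have sm[measurable]: "(\<lambda>x. snd x (Suc k)) \<in> ?Y \<Otimes>\<^sub>M ?G (Suc k) \<rightarrow>\<^sub>M borel"
  proof -
    have "(\<lambda>x. snd x (Suc k)) \<in> ?Y \<Otimes>\<^sub>M ?G (Suc k) \<rightarrow>\<^sub>M PG" by measurable
    then show ?thesis using sets_PG measurable_cong_sets by blast
  qed
  interpret O: prob_space "outcomes \<nu>" by (rule prob_space_outcomes)
  interpret PG: prob_space PG by (rule PG)
  interpret Yk: prob_space ?Y by (rule prob_space_PiM_outcomes)
  interpret Gk: prob_space "?G k" by (rule prob_space_PiM_PG)
  interpret GSk: prob_space "?G (Suc k)" by (rule prob_space_PiM_PG)
  interpret P: pair_sigma_finite ?Y "?G (Suc k)" ..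
  interpret P0: pair_sigma_finite ?Y "?G k" ..
  interpret PY: pair_sigma_finite ?Y PG ..
  let ?f = "\<lambda>Y G. \<Phi> (hist p Y G k, G (Suc k))"
  \<comment> \<open>Coordinate \<open>Suc k\<close> of the randomizations is split off by
    \<open>product_nn_integral_insert\<close>, after \<open>G\<close> has been made the outer
    variable.\<close>
  have eq: "insert (Suc k) {1..k} = {1..Suc k}" by auto
  have "(\<integral>\<^sup>+\<omega>. ?f (fst \<omega>) (snd \<omega>) \<partial>(?Y \<Otimes>\<^sub>M ?G (Suc k))) = (\<integral>\<^sup>+G. \<integral>\<^sup>+Y. ?f Y G \<partial>?Y \<partial>?G (Suc k))"
    by (subst P.nn_integral_snd[symmetric]) auto
  also have "\<dots> = (\<integral>\<^sup>+G. \<integral>\<^sup>+g. \<integral>\<^sup>+Y. ?f Y (G(Suc k := g)) \<partial>?Y \<partial>PG \<partial>?G k)"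
    unfolding eq[symmetric]
  proof (rule Gs.product_nn_integral_insert)
    have "(\<lambda>G. \<integral>\<^sup>+Y. ?f Y G \<partial>?Y) \<in> borel_measurable (?G (Suc k))"
      by (intro Yk.borel_measurable_nn_integral) (simp add: split_beta', measurable)
    then show "(\<lambda>G. \<integral>\<^sup>+Y. ?f Y G \<partial>?Y) \<in> borel_measurable (PiM (insert (Suc k) {1..k}) (\<lambda>_. PG))"
      unfolding eq .
  qed auto
  also have "\<dots> = (\<integral>\<^sup>+G. \<integral>\<^sup>+g. \<integral>\<^sup>+Y. \<Phi> (hist p Y G k, g) \<partial>?Y \<partial>PG \<partial>?G k)"
    by (intro nn_integral_cong) (simp, rule arg_cong[where f=\<Phi>], auto intro!: hist_cong)
  \<comment> \<open>The new randomization moves to the innermost place, so that the two outer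
    integrals become one over \<open>law k\<close>.\<close>
  also have "\<dots> = (\<integral>\<^sup>+G. \<integral>\<^sup>+Y. \<integral>\<^sup>+g. \<Phi> (hist p Y G k, g) \<partial>PG \<partial>?Y \<partial>?G k)"
  proof (intro nn_integral_cong PY.Fubini')
    fix G assume "G \<in> space (?G k)"
    then show "(\<lambda>(Y, g). \<Phi> (hist p Y G k, g)) \<in> borel_measurable (?Y \<Otimes>\<^sub>M PG)"
      unfolding split_beta' by measurable
  qed
  also have "\<dots> = (\<integral>\<^sup>+\<omega>. \<integral>\<^sup>+g. \<Phi> (hist p (fst \<omega>) (snd \<omega>) k, g) \<partial>PG \<partial>(?Y \<Otimes>\<^sub>M ?G k))"
    by (subst P0.nn_integral_snd[symmetric]) auto
  also have "\<dots> = (\<integral>\<^sup>+h. \<integral>\<^sup>+g. \<Phi> (h, g) \<partial>PG \<partial>law k)"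
    unfolding law_def by (subst nn_integral_distr) (auto simp: split_beta')
  finally show ?thesis .
qed

text \<open>This is the transition kernel of the history. The fresh outcome vector is independent of
  the selection of the arm, so it is seen only through the marginal of the selected arm.\<close>

lemma nn_integral_law_Suc:
  assumes k: "Suc k \<le> n" and \<phi>[measurable]: "\<phi> \<in> borel_measurable (histories (Suc k))"
  shows "(\<integral>\<^sup>+h. \<phi> h \<partial>law (Suc k))
    = (\<integral>\<^sup>+h. \<integral>\<^sup>+g. \<integral>\<^sup>+y. \<phi> (h(Suc k := (y, g))) \<partial>\<nu> (p (Suc k) h g) \<partial>PG \<partial>law k)"
proof -
  let ?Y = "\<lambda>k. PiM {1..k::nat} (\<lambda>_. outcomes \<nu>)" and ?G = "\<lambda>k. PiM {1..k::nat} (\<lambda>_. PG)"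
  \<comment> \<open>The integral runs over the whole outcome vector for now, because the selected
    arm varies with \<open>h\<close> and \<open>g\<close>.\<close>
  define \<Phi> where "\<Phi> = (\<lambda>(h, g). \<integral>\<^sup>+y. \<phi> (h(Suc k := (y (p (Suc k) h g), g))) \<partial>outcomes \<nu>)"
  have sel[measurable (raw)]: "(\<lambda>x. f x (a x)) \<in> borel_measurable M"
    if "f \<in> M \<rightarrow>\<^sub>M outcomes \<nu>" "a \<in> M \<rightarrow>\<^sub>M count_space {1..K}" for f a and M :: "'z measure"
  proof -
    have "(\<lambda>x. f x i) \<in> borel_measurable M" if "i \<in> {1..K}" for i
    proof -
      have "(\<lambda>x. f x i) \<in> M \<rightarrow>\<^sub>M \<nu> i"
        using \<open>f \<in> _\<close> \<open>i \<in> _\<close> by measurable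
      then show ?thesis using sets_\<nu> measurable_cong_sets by blast
    qed
    from measurable_compose_countable'[OF this that(2)] show ?thesis by simp
  qed
  have [measurable]: "\<Phi> \<in> borel_measurable (histories k \<Otimes>\<^sub>M borel)"
    unfolding \<Phi>_def split_beta' using k by measurable
  have hm[measurable]: "(\<lambda>x. hist p (fst x) (snd x) (Suc k)) \<in> ?Y (Suc k) \<Otimes>\<^sub>M ?G (Suc k) \<rightarrow>\<^sub>M histories (Suc k)"
    "(\<lambda>x. hist p (fst x) (snd x) k) \<in> ?Y k \<Otimes>\<^sub>M ?G (Suc k) \<rightarrow>\<^sub>M histories k"
    using hist_measurable[of "Suc k" "{1..Suc k}" "{1..Suc k}" \<nu>] hist_measurable[of k "{1..k}" "{1..Suc k}" \<nu>] k
    by (auto simp: split_beta' sets_\<nu> simp del: hist.simps)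
  have hm'[measurable (raw)]: "(\<lambda>x. hist p (f x) (g x) (Suc k)) \<in> M \<rightarrow>\<^sub>M histories (Suc k)"
    if "f \<in> M \<rightarrow>\<^sub>M ?Y (Suc k)" "g \<in> M \<rightarrow>\<^sub>M ?G (Suc k)" for f g and M :: "'z measure"
    using measurable_compose[OF measurable_Pair[OF that] hm(1)] by simp
  have sm[measurable]: "(\<lambda>x. snd x (Suc k)) \<in> ?Y k \<Otimes>\<^sub>M ?G (Suc k) \<rightarrow>\<^sub>M borel"
  proof -
    have "(\<lambda>x. snd x (Suc k)) \<in> ?Y k \<Otimes>\<^sub>M ?G (Suc k) \<rightarrow>\<^sub>M PG" by measurable
    then show ?thesis using sets_PG measurable_cong_sets by blast
  qed
  interpret O: prob_space "outcomes \<nu>" by (rule prob_space_outcomes)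
  interpret PG: prob_space PG by (rule PG)
  interpret Yk: prob_space "?Y k" by (rule prob_space_PiM_outcomes)
  interpret YSk: prob_space "?Y (Suc k)" by (rule prob_space_PiM_outcomes)
  interpret GSk: prob_space "?G (Suc k)" by (rule prob_space_PiM_PG)
  interpret P: pair_sigma_finite "?Y (Suc k)" "?G (Suc k)" ..
  interpret P0: pair_sigma_finite "?Y k" "?G (Suc k)" ..
  have eq: "insert (Suc k) {1..k} = {1..Suc k}" by auto
  have "(\<integral>\<^sup>+h. \<phi> h \<partial>law (Suc k))
      = (\<integral>\<^sup>+\<omega>. \<phi> (hist p (fst \<omega>) (snd \<omega>) (Suc k)) \<partial>(?Y (Suc k) \<Otimes>\<^sub>M ?G (Suc k)))"
    unfolding law_def by (subst nn_integral_distr) (auto simp: split_beta' simp del: hist.simps)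
  also have "\<dots> = (\<integral>\<^sup>+G. \<integral>\<^sup>+Y. \<phi> (hist p Y G (Suc k)) \<partial>?Y (Suc k) \<partial>?G (Suc k))"
    by (subst P.nn_integral_snd[symmetric]) (auto simp del: hist.simps)
  also have "\<dots> = (\<integral>\<^sup>+G. \<integral>\<^sup>+Y. \<integral>\<^sup>+y. \<phi> (hist p (Y(Suc k := y)) G (Suc k)) \<partial>outcomes \<nu> \<partial>?Y k \<partial>?G (Suc k))"
  proof (intro nn_integral_cong)
    fix G assume G: "G \<in> space (?G (Suc k))"
    have "(\<lambda>Y. \<phi> (hist p Y G (Suc k))) \<in> borel_measurable (?Y (Suc k))"
      using G by measurable
    then show "(\<integral>\<^sup>+Y. \<phi> (hist p Y G (Suc k)) \<partial>?Y (Suc k))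
      = (\<integral>\<^sup>+Y. \<integral>\<^sup>+y. \<phi> (hist p (Y(Suc k := y)) G (Suc k)) \<partial>outcomes \<nu> \<partial>?Y k)"
      unfolding eq[symmetric] by (intro Ys.product_nn_integral_insert) auto
  qed
  also have "\<dots> = (\<integral>\<^sup>+G. \<integral>\<^sup>+Y. \<Phi> (hist p Y G k, G (Suc k)) \<partial>?Y k \<partial>?G (Suc k))"
  proof -
    have "hist p (Y(Suc k := y)) G k = hist p Y G k" for Y y G
      by (rule hist_cong) auto
    then show ?thesis by (simp add: \<Phi>_def)
  qed
  also have "\<dots> = (\<integral>\<^sup>+\<omega>. \<Phi> (hist p (fst \<omega>) (snd \<omega>) k, snd \<omega> (Suc k)) \<partial>(?Y k \<Otimes>\<^sub>M ?G (Suc k)))"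
    by (subst P0.nn_integral_snd[symmetric]) auto
  also have "\<dots> = (\<integral>\<^sup>+h. \<integral>\<^sup>+g. \<Phi> (h, g) \<partial>PG \<partial>law k)"
    using k by (intro nn_integral_hist_randomization) auto
  also have "\<dots> = (\<integral>\<^sup>+h. \<integral>\<^sup>+g. \<integral>\<^sup>+y. \<phi> (h(Suc k := (y, g))) \<partial>\<nu> (p (Suc k) h g) \<partial>PG \<partial>law k)"
  proof (intro nn_integral_cong)
    \<comment> \<open>Once \<open>h\<close> and \<open>g\<close> are fixed, so is the arm, and the
      outcome vector can be projected to a single marginal.\<close>
    fix h g assume "h \<in> space (law k)"
    then have h: "h \<in> space (histories k)" by simp
    with k have i: "p (Suc k) h g \<in> {1..K}" by (rule p_range)
    have "(\<lambda>y. \<phi> (h(Suc k := (y, g)))) \<in> borel_measurable (\<nu> (p (Suc k) h g))"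
      by (intro measurable_compose[OF _ \<phi>] history_upd_measurable measurable_const[OF h] measurable_const
          measurable_ident_sets[OF sets_\<nu>]) auto
    then show "\<Phi> (h, g) = (\<integral>\<^sup>+y. \<phi> (h(Suc k := (y, g))) \<partial>\<nu> (p (Suc k) h g))"
      using i by (subst distr_PiM_component[OF prob_\<nu> i, symmetric], subst nn_integral_distr) (auto simp: \<Phi>_def)
  qed
  finally show ?thesis .
qed

text \<open>The measure of integration itself depends on the point, but only through the selected
  arm, so each arm is treated separately.\<close>

lemma kernel_measurable[measurable]:
  assumes "Suc k \<le> n" and \<phi>[measurable]: "\<phi> \<in> borel_measurable (histories (Suc k))"
  shows "(\<lambda>(h, g). \<integral>\<^sup>+y. \<phi> (h(Suc k := (y, g))) \<partial>\<nu> (p (Suc k) h g)) \<in> borel_measurable (histories k \<Otimes>\<^sub>M borel)"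
  unfolding split_beta'
proof (rule measurable_compose_countable'[where I="{1..K}" and g="\<lambda>x. p (Suc k) (fst x) (snd x)"
      and f="\<lambda>i x. \<integral>\<^sup>+y. \<phi> ((fst x)(Suc k := (y, snd x))) \<partial>\<nu> i"])
  fix i
  interpret prob_space "\<nu> i" by (rule prob_\<nu>)
  show "(\<lambda>x. \<integral>\<^sup>+y. \<phi> ((fst x)(Suc k := (y, snd x))) \<partial>\<nu> i) \<in> borel_measurable (histories k \<Otimes>\<^sub>M borel)"
    by measurable
qed (use assms in auto)

lemma nn_integral_law_0: "\<phi> \<in> borel_measurable (histories 0) \<Longrightarrow> (\<integral>\<^sup>+h. \<phi> h \<partial>law 0) = \<phi> (\<lambda>_. undefined)"
proof -
  interpret prob_space "law 0" by (rule prob_space_law) simp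
  have "(\<integral>\<^sup>+h. \<phi> h \<partial>law 0) = (\<integral>\<^sup>+h. \<phi> (\<lambda>_. undefined) \<partial>law 0)"
    by (intro nn_integral_cong) (simp add: space_PiM)
  then show ?thesis using emeasure_space_1 by simp
qed

lemma history_upd_section_measurable:
  assumes k: "Suc k \<le> n" and h: "h \<in> space (histories k)"
    and \<phi>[measurable]: "\<phi> \<in> borel_measurable (histories (Suc k))"
  shows "(\<lambda>y. \<phi> (h(Suc k := (y, g)))) \<in> borel_measurable (\<nu> i)"
  by (intro measurable_compose[OF _ \<phi>] history_upd_measurable measurable_const[OF h] measurable_const
          measurable_ident_sets[OF sets_\<nu>]) auto

text \<open>The earlier rounds are constant in the inner integrals, whose measures have mass 1. In
  the last term \<open>c\<close> enters only through its mean under each arm law, which is what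
  Wald's identity exploits.\<close>

lemma nn_integral_additive_Suc:
  assumes k: "Suc k \<le> n" and c[measurable]: "\<And>i. c i \<in> borel_measurable borel"
  shows "(\<integral>\<^sup>+h. (\<Sum>t\<in>{1..Suc k}. c (act t h) (fst (h t))) \<partial>law (Suc k))
    = (\<integral>\<^sup>+h. (\<Sum>t\<in>{1..k}. c (act t h) (fst (h t))) \<partial>law k)
      + (\<integral>\<^sup>+h. \<integral>\<^sup>+g. \<integral>\<^sup>+y. c (p (Suc k) h g) y \<partial>\<nu> (p (Suc k) h g) \<partial>PG \<partial>law k)"
proof -
  interpret PG: prob_space PG by (rule PG)
  let ?S = "\<lambda>k h. \<Sum>t\<in>{1..k}. c (act t h) (fst (h t))"
  have S[measurable]: "?S k' \<in> borel_measurable (histories k')" if "k' \<le> n" for k'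
    using that by (intro borel_measurable_sum act_reward_measurable) auto
  have C: "(\<lambda>x. \<integral>\<^sup>+y. c (p (Suc k) (fst x) (snd x)) y \<partial>\<nu> (p (Suc k) (fst x) (snd x))) \<in> borel_measurable (histories k \<Otimes>\<^sub>M borel)"
    by (rule measurable_compose_countable'[where I="{1..K}" and g="\<lambda>x. p (Suc k) (fst x) (snd x)"
          and f="\<lambda>i x. \<integral>\<^sup>+y. c i y \<partial>\<nu> i"]) (use k in auto)
  have C'[measurable (raw)]: "(\<lambda>x. \<integral>\<^sup>+y. c (p (Suc k) (f x) (g x)) y \<partial>\<nu> (p (Suc k) (f x) (g x))) \<in> borel_measurable M"
    if "f \<in> M \<rightarrow>\<^sub>M histories k" "g \<in> borel_measurable M" for f g and M :: "'z measure"
    using measurable_compose[OF measurable_Pair[OF that] C] by simp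
  have "(\<integral>\<^sup>+h. ?S (Suc k) h \<partial>law (Suc k))
    = (\<integral>\<^sup>+h. \<integral>\<^sup>+g. \<integral>\<^sup>+y. ?S (Suc k) (h(Suc k := (y, g))) \<partial>\<nu> (p (Suc k) h g) \<partial>PG \<partial>law k)"
    using k by (intro nn_integral_law_Suc S)
  also have "\<dots> = (\<integral>\<^sup>+h. \<integral>\<^sup>+g. \<integral>\<^sup>+y. ?S k h + c (p (Suc k) h g) y \<partial>\<nu> (p (Suc k) h g) \<partial>PG \<partial>law k)"
    by (intro nn_integral_cong) (simp add: act_upd act_upd_last)
  also have "\<dots> = (\<integral>\<^sup>+h. \<integral>\<^sup>+g. ?S k h + (\<integral>\<^sup>+y. c (p (Suc k) h g) y \<partial>\<nu> (p (Suc k) h g)) \<partial>PG \<partial>law k)"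
  proof (intro nn_integral_cong)
    fix h g
    interpret N: prob_space "\<nu> (p (Suc k) h g)" by (rule prob_\<nu>)
    show "(\<integral>\<^sup>+y. ?S k h + c (p (Suc k) h g) y \<partial>\<nu> (p (Suc k) h g))
      = ?S k h + (\<integral>\<^sup>+y. c (p (Suc k) h g) y \<partial>\<nu> (p (Suc k) h g))"
      by (subst nn_integral_add) (auto simp: N.emeasure_space_1)
  qed
  also have "\<dots> = (\<integral>\<^sup>+h. ?S k h + (\<integral>\<^sup>+g. \<integral>\<^sup>+y. c (p (Suc k) h g) y \<partial>\<nu> (p (Suc k) h g) \<partial>PG) \<partial>law k)"
    by (intro nn_integral_cong, subst nn_integral_add) (auto simp: PG.emeasure_space_1)
  also have "\<dots> = (\<integral>\<^sup>+h. ?S k h \<partial>law k) + (\<integral>\<^sup>+h. \<integral>\<^sup>+g. \<integral>\<^sup>+y. c (p (Suc k) h g) y \<partial>\<nu> (p (Suc k) h g) \<partial>PG \<partial>law k)"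
  proof (rule nn_integral_add)
    show "?S k \<in> borel_measurable (law k)" using S[of k] k by simp
  qed measurable
  finally show ?thesis .
qed

text \<open>Wald's identity for the adaptively chosen arms.\<close>
lemma nn_integral_additive:
  assumes k: "k \<le> n" and c[measurable]: "\<And>i. c i \<in> borel_measurable borel"
  shows "(\<integral>\<^sup>+h. (\<Sum>t\<in>{1..k}. c (act t h) (fst (h t))) \<partial>law k)
    = (\<integral>\<^sup>+h. (\<Sum>t\<in>{1..k}. \<integral>\<^sup>+y. c (act t h) y \<partial>\<nu> (act t h)) \<partial>law k)"
  using k
proof (induction k)
  case 0
  show ?case by simp
next
  case (Suc k)
  \<comment> \<open>A function that does not depend on the outcome is its own mean. The recursion
    for the means thus has the same last term as that for \<open>c\<close>, and both sides of the
    claim obey one recursion.\<close>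
  have "(\<integral>\<^sup>+y. d \<partial>\<nu> i) = d" for d :: ennreal and i
    using prob_space.emeasure_space_1[OF prob_\<nu>] by simp
  then show ?case
    using Suc nn_integral_additive_Suc[of k c]
      nn_integral_additive_Suc[of k "\<lambda>i y. \<integral>\<^sup>+y. c i y \<partial>\<nu> i"]
    by simp
qed

end

section \<open>Change of environment\<close>

text \<open>
  The term linear in \<open>x\<close> integrates to a constant when \<open>x\<close> is a likelihood ratio, so the
  inequality bounds the testing affinity from below by the Kullback-Leibler divergence.
\<close>
lemma min_likelihood_ge:
  fixes x :: real
  assumes "0 < x"
  shows "3/4 + ln x / 2 \<le> 3/4 * min 1 x + x / 4"
proof (cases "x \<le> 1")
  case True
  \<comment> \<open>Tangent of the logarithm at 1/2, where \<open>ln x / 2\<close> has slope 1, the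
    slope of the right side below 1.\<close>
  have "ln (2 * x) \<le> 2 * x - 1" using assms by (intro ln_le_minus_one) auto
  then have "ln x \<le> 2 * x - 1 - ln 2" using assms by (simp add: ln_mult)
  moreover have "ln 2 \<ge> (2/3 :: real)" by (rule ln2_ge_two_thirds)
  ultimately show ?thesis using True by simp
next
  case False
  \<comment> \<open>Tangent at 2, where \<open>ln x / 2\<close> has slope 1/4, the slope of the
    right side above 1.\<close>
  have "ln (x / 2) \<le> x / 2 - 1" using assms by (intro ln_le_minus_one) auto
  then have "ln x \<le> x / 2 - 1 + ln 2" using assms by (simp add: ln_div)
  moreover have "ln 2 \<le> (1 :: real)" using ln_le_minus_one[of "2::real"] by simp
  ultimately show ?thesis using False by (simp add: field_simps)
qed

text \<open>The parameter \<delta> bounds the relative change of the outcome laws, and the value 1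
  outside \<open>H\<close> means that only pulls inside the block distinguish the environments. The
  limit 1/2 keeps the densities positive and is the range of the quadratic bound for the
  logarithm.\<close>

locale bandit_change = E0: bandit_environment K n p PG \<nu> + E1: bandit_environment K n p PG \<nu>'
  for K n p PG \<nu> \<nu>' +
  fixes \<rho> :: "nat \<Rightarrow> real \<Rightarrow> real" and H :: "nat set" and \<delta> :: real
  assumes \<rho>_measurable[measurable]: "\<rho> i \<in> borel_measurable borel"
    and \<delta>: "0 \<le> \<delta>" "\<delta> \<le> 1/2"
    and \<rho>_bounds: "1 - \<delta> \<le> \<rho> i y" "\<rho> i y \<le> 1 + \<delta>"
    and density: "i \<in> {1..K} \<Longrightarrow> \<nu>' i = density (\<nu> i) (\<lambda>y. ennreal (\<rho> i y))"
    and \<rho>_outside: "i \<notin> H \<Longrightarrow> \<rho> i y = 1"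
begin

text \<open>The policy and the randomizations are common to both environments and cancel, so the
  likelihood ratio of the history retains only the densities of the observed outcomes.\<close>

definition LR :: "nat \<Rightarrow> (nat \<Rightarrow> real \<times> real) \<Rightarrow> real" where
  "LR k h = (\<Prod>t\<in>{1..k}. \<rho> (E0.act t h) (fst (h t)))"

lemma \<rho>_pos: "0 < \<rho> i y"
  using \<rho>_bounds(1)[of i y] \<delta> by linarith

lemma LR_pos: "0 < LR k h"
  by (auto simp: LR_def intro!: prod_pos \<rho>_pos)

lemma LR_measurable[measurable]: "k \<le> n \<Longrightarrow> LR k \<in> borel_measurable (E0.histories k)"
  unfolding LR_def by (intro borel_measurable_prod E0.act_reward_measurable) auto

lemma LR_Suc:
  "h \<in> space (E0.histories k) \<Longrightarrow>
    LR (Suc k) (h(Suc k := (y, g))) = LR k h * \<rho> (p (Suc k) h g) y"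
  by (simp add: LR_def E0.act_upd E0.act_upd_last)

text \<open>Induction along the transition kernel, with a general integrand because the hypothesis
  is applied to the integral over the last round.\<close>

lemma nn_integral_law_change:
  assumes "k \<le> n" "\<phi> \<in> borel_measurable (E0.histories k)"
  shows "(\<integral>\<^sup>+h. \<phi> h \<partial>E1.law k) = (\<integral>\<^sup>+h. ennreal (LR k h) * \<phi> h \<partial>E0.law k)"
  using assms
proof (induction k arbitrary: \<phi>)
  case 0
  have "(\<lambda>h. ennreal (LR 0 h) * \<phi> h) \<in> borel_measurable (E0.histories 0)"
    using 0 by measurable
  then show ?case using 0 by (simp add: E0.nn_integral_law_0 E1.nn_integral_law_0 LR_def)
next
  case (Suc k)
  note [measurable] = Suc.prems(2)
  have k: "Suc k \<le> n" "k \<le> n" using Suc.prems by auto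
  let ?I = "\<lambda>h g. \<integral>\<^sup>+y. \<phi> (h(Suc k := (y, g))) \<partial>\<nu>' (p (Suc k) h g)"
  interpret PG: prob_space PG by (rule E0.PG)
  have I[measurable]: "(\<lambda>(h, g). ?I h g) \<in> borel_measurable (E0.histories k \<Otimes>\<^sub>M borel)"
    using Suc.prems by (intro E1.kernel_measurable) auto
  have "(\<integral>\<^sup>+h. \<phi> h \<partial>E1.law (Suc k)) = (\<integral>\<^sup>+h. (\<integral>\<^sup>+g. ?I h g \<partial>PG) \<partial>E1.law k)"
    using Suc.prems by (intro E1.nn_integral_law_Suc) auto
  also have "\<dots> = (\<integral>\<^sup>+h. ennreal (LR k h) * (\<integral>\<^sup>+g. ?I h g \<partial>PG) \<partial>E0.law k)"
    using k by (intro Suc.IH) measurable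
  also have "\<dots> = (\<integral>\<^sup>+h. (\<integral>\<^sup>+g. \<integral>\<^sup>+y. ennreal (LR (Suc k) (h(Suc k := (y, g)))) * \<phi> (h(Suc k := (y, g)))
      \<partial>\<nu> (p (Suc k) h g) \<partial>PG) \<partial>E0.law k)"
  proof (intro nn_integral_cong)
    fix h assume "h \<in> space (E0.law k)"
    then have h: "h \<in> space (E0.histories k)" by simp
    have sec: "(\<lambda>y. \<phi> (h(Suc k := (y, g)))) \<in> borel_measurable (\<nu> i)" for g i
      by (rule E0.history_upd_section_measurable[OF k(1) h Suc.prems(2)])
    have \<rho>m[measurable]: "\<rho> i \<in> borel_measurable (\<nu> i')" for i i'
      using \<rho>_measurable measurable_cong_sets[OF E0.sets_\<nu> refl] by blast
    have "ennreal (LR k h) * (\<integral>\<^sup>+g. ?I h g \<partial>PG) = (\<integral>\<^sup>+g. ennreal (LR k h) * ?I h g \<partial>PG)"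
      by (rule nn_integral_cmult[symmetric]) (use h in measurable)
    also have "\<dots> = (\<integral>\<^sup>+g. \<integral>\<^sup>+y. ennreal (LR (Suc k) (h(Suc k := (y, g)))) * \<phi> (h(Suc k := (y, g)))
      \<partial>\<nu> (p (Suc k) h g) \<partial>PG)"
    proof (intro nn_integral_cong)
      fix g
      let ?i = "p (Suc k) h g"
      have i: "?i \<in> {1..K}" by (rule E0.p_range[OF k(1) h])
      have "?I h g = (\<integral>\<^sup>+y. ennreal (\<rho> ?i y) * \<phi> (h(Suc k := (y, g))) \<partial>\<nu> ?i)"
        unfolding density[OF i] by (subst nn_integral_density) (auto intro: sec)
      then have "ennreal (LR k h) * ?I h g
          = (\<integral>\<^sup>+y. ennreal (LR k h) * (ennreal (\<rho> ?i y) * \<phi> (h(Suc k := (y, g)))) \<partial>\<nu> ?i)"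
        by (simp only:) (intro nn_integral_cmult[symmetric] borel_measurable_times_ennreal sec
            measurable_compose[OF \<rho>m measurable_ennreal])
      also have "\<dots> = (\<integral>\<^sup>+y. ennreal (LR (Suc k) (h(Suc k := (y, g)))) * \<phi> (h(Suc k := (y, g))) \<partial>\<nu> ?i)"
        using LR_pos[of k h] \<rho>_pos by (intro nn_integral_cong) (simp add: LR_Suc[OF h] ennreal_mult less_imp_le mult.assoc)
      finally show "ennreal (LR k h) * ?I h g = \<dots>" .
    qed
    finally show "ennreal (LR k h) * (\<integral>\<^sup>+g. ?I h g \<partial>PG) = \<dots>" .
  qed
  also have "\<dots> = (\<integral>\<^sup>+h. ennreal (LR (Suc k) h) * \<phi> h \<partial>E0.law (Suc k))"
    using k Suc.prems LR_measurable[OF k(1)] by (intro E0.nn_integral_law_Suc[symmetric]) measurable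
  finally show ?case .
qed

text \<open>The divergence of one pull is quadratic in \<delta>: the linear term of the logarithm
  averages to 0 because a density has mean 1. The added 1 makes the integrand nonnegative.\<close>

lemma nn_integral_neg_log_le:
  assumes i: "i \<in> {1..K}"
  shows "(\<integral>\<^sup>+y. ennreal (1 - ln (\<rho> i y)) \<partial>\<nu> i) \<le> 1 + ennreal (2 * \<delta>\<^sup>2) * indicator H i"
proof (cases "i \<in> H")
  case False
  then show ?thesis
    using prob_space.emeasure_space_1[OF E0.prob_\<nu>[of i]] by (simp add: \<rho>_outside)
next
  case True
  interpret N: prob_space "\<nu> i" by (rule E0.prob_\<nu>)
  interpret N': prob_space "\<nu>' i" by (rule E1.prob_\<nu>)
  have [measurable]: "\<rho> i \<in> borel_measurable (\<nu> i)"
    using \<rho>_measurable measurable_cong_sets[OF E0.sets_\<nu> refl] by blast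
  have int: "integrable (\<nu> i) (\<rho> i)"
    by (rule N.integrable_const_bound[of _ "1 + \<delta>"]) (use \<rho>_bounds \<rho>_pos in \<open>auto simp: less_imp_le\<close>)
  have "emeasure (\<nu>' i) (space (\<nu>' i)) = (\<integral>\<^sup>+y. ennreal (\<rho> i y) \<partial>\<nu> i)"
    unfolding density[OF i] by (subst emeasure_density) (auto intro!: nn_integral_cong)
  then have "(\<integral>\<^sup>+y. ennreal (\<rho> i y) \<partial>\<nu> i) = ennreal 1" using N'.emeasure_space_1 by simp
  then have one: "(\<integral>y. \<rho> i y \<partial>\<nu> i) = 1"
    using nn_integral_eq_integral[OF int] \<rho>_pos by (simp add: less_imp_le integral_nonneg)
  \<comment> \<open>The second bound is \<open>- ln x \<le> (1 - x) + 2 * (x - 1)\<^sup>2\<close> at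
    the density, with 1 added on both sides and the square bounded by
    \<open>\<delta>\<^sup>2\<close>.\<close>
  have pw: "0 \<le> 1 - ln (\<rho> i y)" "1 - ln (\<rho> i y) \<le> 2 + 2 * \<delta>\<^sup>2 - \<rho> i y" for y
  proof -
    have b: "\<bar>\<rho> i y - 1\<bar> \<le> \<delta>" using \<rho>_bounds[of i y] by auto
    have "\<bar>ln (1 + (\<rho> i y - 1)) - (\<rho> i y - 1)\<bar> \<le> 2 * (\<rho> i y - 1)\<^sup>2"
      using b \<delta> by (intro abs_ln_one_plus_x_minus_x_bound) auto
    moreover have "(\<rho> i y - 1)\<^sup>2 \<le> \<delta>\<^sup>2" using b \<delta> by (simp add: abs_le_square_iff[symmetric])
    ultimately show "1 - ln (\<rho> i y) \<le> 2 + 2 * \<delta>\<^sup>2 - \<rho> i y" by auto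
    have "ln (\<rho> i y) \<le> \<rho> i y - 1" by (intro ln_le_minus_one \<rho>_pos)
    then show "0 \<le> 1 - ln (\<rho> i y)" using b \<delta> by linarith
  qed
  have "(\<integral>\<^sup>+y. ennreal (1 - ln (\<rho> i y)) \<partial>\<nu> i) \<le> (\<integral>\<^sup>+y. ennreal (2 + 2 * \<delta>\<^sup>2 - \<rho> i y) \<partial>\<nu> i)"
    using pw by (intro nn_integral_mono ennreal_leI) auto
  also have "\<dots> = ennreal (\<integral>y. 2 + 2 * \<delta>\<^sup>2 - \<rho> i y \<partial>\<nu> i)"
  proof (rule nn_integral_eq_integral)
    show "integrable (\<nu> i) (\<lambda>y. 2 + 2 * \<delta>\<^sup>2 - \<rho> i y)" using int by simp
    show "AE y in \<nu> i. 0 \<le> 2 + 2 * \<delta>\<^sup>2 - \<rho> i y" using pw by (intro AE_I2) (meson order_trans)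
  qed
  also have "\<dots> = ennreal (1 + 2 * \<delta>\<^sup>2)" using int one by (simp add: N.prob_space)
  finally show ?thesis using True by simp
qed

text \<open>\<open>min_likelihood_ge\<close> is integrated at the likelihood ratio, which has mean
  1. As \<open>pulls\<close> bounds the divergence by 1/4, the affinity V satisfies 3/4 - 1/8 \<le>
  3/4 V + 1/4, that is, V \<ge> 1/2.\<close>

lemma affinity_ge:
  assumes pulls: "ennreal (2 * \<delta>\<^sup>2) * (\<integral>\<^sup>+h. (\<Sum>t\<in>{1..n}. indicator H (E0.act t h)) \<partial>E0.law n) \<le> ennreal (1/4)"
  shows "(\<integral>\<^sup>+h. ennreal (min 1 (LR n h)) \<partial>E0.law n) \<ge> ennreal (1/2)"
proof -
  interpret L0: prob_space "E0.law n" by (rule E0.prob_space_law) simp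
  interpret L1: prob_space "E1.law n" by (rule E1.prob_space_law) simp
  let ?V = "\<integral>\<^sup>+h. ennreal (min 1 (LR n h)) \<partial>E0.law n"
  let ?c = "\<lambda>i y. 1 - ln (\<rho> i y)"
  have c0: "0 \<le> ?c i y" for i y
    using ln_le_minus_one[OF \<rho>_pos[of i y]] \<rho>_bounds[of i y] \<delta> by linarith
  have [measurable]: "LR n \<in> borel_measurable (E0.law n)"
    using LR_measurable[of n] by simp
  have cm: "(\<lambda>h. ennreal (?c (E0.act t h) (fst (h t)))) \<in> borel_measurable (E0.law n)" if "t \<in> {1..n}" for t
  proof -
    have "(\<lambda>h. ennreal (?c (E0.act t h) (fst (h t)))) \<in> borel_measurable (E0.histories n)"
      using that by (intro E0.act_reward_measurable[where c="\<lambda>i y. ennreal (?c i y)"]) auto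
    then show ?thesis by simp
  qed
  have LR1: "(\<integral>\<^sup>+h. ennreal (LR n h) \<partial>E0.law n) = 1"
    using nn_integral_law_change[of n "\<lambda>_. 1"] L1.emeasure_space_1 by simp
  \<comment> \<open>Every round carries the added 1, hence the \<open>real n\<close>; half of it
    cancels against \<open>real n / 2\<close> in the final comparison.\<close>
  have cost: "(\<integral>\<^sup>+h. (\<Sum>t\<in>{1..n}. ennreal (?c (E0.act t h) (fst (h t)))) \<partial>E0.law n) \<le> ennreal (real n + 1/4)"
  proof -
    have "(\<integral>\<^sup>+h. (\<Sum>t\<in>{1..n}. ennreal (?c (E0.act t h) (fst (h t)))) \<partial>E0.law n)
      = (\<integral>\<^sup>+h. (\<Sum>t\<in>{1..n}. \<integral>\<^sup>+y. ennreal (?c (E0.act t h) y) \<partial>\<nu> (E0.act t h)) \<partial>E0.law n)"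
      by (rule E0.nn_integral_additive) auto
    also have "\<dots> \<le> (\<integral>\<^sup>+h. (\<Sum>t\<in>{1..n}. 1 + ennreal (2 * \<delta>\<^sup>2) * indicator H (E0.act t h)) \<partial>E0.law n)"
      by (intro nn_integral_mono sum_mono nn_integral_neg_log_le E0.act_range)
    also have "\<dots> = (\<integral>\<^sup>+h. of_nat n + ennreal (2 * \<delta>\<^sup>2) * (\<Sum>t\<in>{1..n}. indicator H (E0.act t h)) \<partial>E0.law n)"
      by (simp add: sum.distrib sum_distrib_left)
    also have "\<dots> = of_nat n + ennreal (2 * \<delta>\<^sup>2) * (\<integral>\<^sup>+h. (\<Sum>t\<in>{1..n}. indicator H (E0.act t h)) \<partial>E0.law n)"
      using E0.indicator_act_measurable[of _ H] by (simp add: nn_integral_add nn_integral_cmult L0.emeasure_space_1[unfolded E0.space_law])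
    also have "\<dots> \<le> of_nat n + ennreal (1/4)"
      by (intro add_left_mono pulls)
    also have "\<dots> = ennreal (real n + 1/4)" by (simp add: ennreal_of_nat_eq_real_of_nat)
    finally show ?thesis .
  qed
  have split: "ennreal (3/4 * x + 1/4 * y + 1/2 * z) = ennreal (3/4) * ennreal x + ennreal (1/4) * ennreal y + ennreal (1/2) * ennreal z"
    if "0 \<le> x" "0 \<le> y" "0 \<le> z" for x y z
  proof -
    have "ennreal (3/4 * x + 1/4 * y + 1/2 * z) = ennreal (3/4 * x) + ennreal (1/4 * y) + ennreal (1/2 * z)"
      using that by simp
    also have "\<dots> = ennreal (3/4) * ennreal x + ennreal (1/4) * ennreal y + ennreal (1/2) * ennreal z"
      using that by (intro arg_cong2[where f="(+)"] ennreal_mult) auto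
    finally show ?thesis .
  qed
  have "ennreal (3/4 + real n / 2) \<le> ennreal (3/4) * ?V + ennreal (1/4) * 1
      + ennreal (1/2) * (\<integral>\<^sup>+h. (\<Sum>t\<in>{1..n}. ennreal (?c (E0.act t h) (fst (h t)))) \<partial>E0.law n)"
  proof -
    have "ennreal (3/4 + real n / 2) = (\<integral>\<^sup>+h. ennreal (3/4 + real n / 2) \<partial>E0.law n)"
      using L0.emeasure_space_1 by (simp add: nn_integral_const del: ennreal_plus E0.space_law)
    also have "\<dots> \<le> (\<integral>\<^sup>+h. ennreal (3/4) * ennreal (min 1 (LR n h)) + ennreal (1/4) * ennreal (LR n h)
        + ennreal (1/2) * (\<Sum>t\<in>{1..n}. ennreal (?c (E0.act t h) (fst (h t)))) \<partial>E0.law n)"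
    proof (intro nn_integral_mono)
      fix h
      have "ln (LR n h) = (\<Sum>t\<in>{1..n}. ln (\<rho> (E0.act t h) (fst (h t))))"
        unfolding LR_def by (rule ln_prod) (simp_all add: order_less_imp_not_eq2[OF \<rho>_pos] \<rho>_pos)
      then have "(\<Sum>t\<in>{1..n}. ?c (E0.act t h) (fst (h t))) = real n - ln (LR n h)"
        by (simp add: sum_subtractf)
      then have "3/4 + real n / 2 \<le> 3/4 * min 1 (LR n h) + 1/4 * LR n h
          + 1/2 * (\<Sum>t\<in>{1..n}. ?c (E0.act t h) (fst (h t)))"
        using min_likelihood_ge[OF LR_pos[of n h]] by (simp add: field_simps)
      then have "ennreal (3/4 + real n / 2) \<le> ennreal (3/4 * min 1 (LR n h) + 1/4 * LR n h
          + 1/2 * (\<Sum>t\<in>{1..n}. ?c (E0.act t h) (fst (h t))))" by (rule ennreal_leI)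
      also have "\<dots> = ennreal (3/4) * ennreal (min 1 (LR n h)) + ennreal (1/4) * ennreal (LR n h)
        + ennreal (1/2) * (\<Sum>t\<in>{1..n}. ennreal (?c (E0.act t h) (fst (h t))))"
        unfolding sum_ennreal[of "{1..n}" "\<lambda>t. ?c (E0.act t h) (fst (h t))", OF c0]
        using LR_pos[of n h] by (intro split sum_nonneg c0) auto
      finally show "ennreal (3/4 + real n / 2) \<le> \<dots>" .
    qed
    also have "\<dots> = ennreal (3/4) * ?V + ennreal (1/4) * (\<integral>\<^sup>+h. ennreal (LR n h) \<partial>E0.law n)
      + ennreal (1/2) * (\<integral>\<^sup>+h. (\<Sum>t\<in>{1..n}. ennreal (?c (E0.act t h) (fst (h t)))) \<partial>E0.law n)"
      using cm by (simp add: nn_integral_add nn_integral_cmult)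
    finally show ?thesis unfolding LR1 .
  qed
  also have "\<dots> \<le> ennreal (3/4) * ?V + ennreal (1/4) * 1 + ennreal (1/2) * ennreal (real n + 1/4)"
    by (intro add_left_mono mult_left_mono cost) auto
  finally have main: "ennreal (3/4 + real n / 2) \<le> ennreal (3/4) * ?V + ennreal (1/4) * 1 + ennreal (1/2) * ennreal (real n + 1/4)" .
  show ?thesis
  proof (cases ?V)
    case (real v)
    have "ennreal (3/4 + real n / 2) \<le> ennreal (3/4 * v + 1/4 + 1/2 * (real n + 1/4))"
      using main real by (subst split[of v 1 "real n + 1/4", simplified mult_1_right]) (simp_all del: ennreal_plus)
    then have "3/4 + real n / 2 \<le> 3/4 * v + 1/4 + 1/2 * (real n + 1/4)"
      using real by (subst (asm) ennreal_le_iff) auto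
    then have "1/2 \<le> v" by (simp add: field_simps)
    then show ?thesis unfolding real by (rule ennreal_leI)
  qed simp
qed

text \<open>Le Cam's two-point argument. The tests are functions with sum 1 rather than indicators,
  because the recommendation is still random when the history is known.\<close>

lemma testing_error_ge:
  assumes pulls: "ennreal (2 * \<delta>\<^sup>2) * (\<integral>\<^sup>+h. (\<Sum>t\<in>{1..n}. indicator H (E0.act t h)) \<partial>E0.law n) \<le> ennreal (1/4)"
    and [measurable]: "\<phi> \<in> borel_measurable (E0.histories n)" "\<phi>' \<in> borel_measurable (E0.histories n)"
    and sum: "\<And>h. h \<in> space (E0.histories n) \<Longrightarrow> \<phi> h + \<phi>' h = 1"
  shows "ennreal (1/2) \<le> (\<integral>\<^sup>+h. \<phi> h \<partial>E0.law n) + (\<integral>\<^sup>+h. \<phi>' h \<partial>E1.law n)"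
proof -
  have [measurable]: "LR n \<in> borel_measurable (E0.law n)"
    using LR_measurable[of n] by simp
  have "ennreal (1/2) \<le> (\<integral>\<^sup>+h. ennreal (min 1 (LR n h)) \<partial>E0.law n)" by (rule affinity_ge[OF pulls])
  also have "\<dots> \<le> (\<integral>\<^sup>+h. \<phi> h + ennreal (LR n h) * \<phi>' h \<partial>E0.law n)"
  proof (intro nn_integral_mono)
    fix h assume "h \<in> space (E0.law n)"
    then have s: "\<phi> h + \<phi>' h = 1" using sum by simp
    let ?m = "ennreal (min 1 (LR n h))"
    \<comment> \<open>Splitting by the sum 1 lets the minimum be bounded by 1 in one term and by the
      ratio in the other.\<close>
    have "?m = ?m * \<phi> h + ?m * \<phi>' h" using s by (simp flip: distrib_left)
    also have "\<dots> \<le> 1 * \<phi> h + ennreal (LR n h) * \<phi>' h"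
      by (intro add_mono mult_right_mono) (auto intro: ennreal_leI simp flip: ennreal_1)
    finally show "?m \<le> \<phi> h + ennreal (LR n h) * \<phi>' h" by simp
  qed
  also have "\<dots> = (\<integral>\<^sup>+h. \<phi> h \<partial>E0.law n) + (\<integral>\<^sup>+h. ennreal (LR n h) * \<phi>' h \<partial>E0.law n)"
    by (rule nn_integral_add) measurable
  also have "(\<integral>\<^sup>+h. ennreal (LR n h) * \<phi>' h \<partial>E0.law n) = (\<integral>\<^sup>+h. \<phi>' h \<partial>E1.law n)"
    by (rule nn_integral_law_change[symmetric]) auto
  finally show ?thesis .
qed

end

section \<open>Regret along the mixture path\<close>

lemma ip_measurable[measurable]: "ip K v \<in> borel_measurable (borel :: (nat \<Rightarrow> real) measure)"
  unfolding ip_def[abs_def]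
  by (intro borel_measurable_sum borel_measurable_times borel_measurable_const
      borel_measurable_continuous_onI continuous_on_product_coordinates)

lemma ip_bounds:
  assumes "\<delta> \<in> unit_simplex K" "\<And>i. i \<in> {1..K} \<Longrightarrow> l \<le> v i \<and> v i \<le> u"
  shows "l \<le> ip K v \<delta>" "ip K v \<delta> \<le> u"
proof -
  have s: "(\<Sum>i=1..K. \<delta> i) = 1" and nn: "\<And>i. i \<in> {1..K} \<Longrightarrow> 0 \<le> \<delta> i"
    using assms(1) by (auto simp: unit_simplex_def)
  have "l = (\<Sum>i=1..K. l * \<delta> i)" "u = (\<Sum>i=1..K. u * \<delta> i)" using s by (simp_all flip: sum_distrib_left)
  moreover have "(\<Sum>i=1..K. l * \<delta> i) \<le> ip K v \<delta>" "ip K v \<delta> \<le> (\<Sum>i=1..K. u * \<delta> i)"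
    unfolding ip_def using assms(2) nn by (auto intro!: sum_mono mult_right_mono)
  ultimately show "l \<le> ip K v \<delta>" "ip K v \<delta> \<le> u" by simp_all
qed

lemma ip_affine:
  assumes "\<delta> \<in> unit_simplex K"
  shows "ip K (\<lambda>i. c + e * v i) \<delta> = c + e * ip K v \<delta>"
proof -
  have "(\<Sum>i=1..K. \<delta> i) = 1" using assms by (auto simp: unit_simplex_def)
  then show ?thesis
    by (simp add: ip_def distrib_right sum.distrib mult.assoc flip: sum_distrib_left)
qed

lemma sum_indicator_partition:
  assumes "partition_on A P" "finite A" "i \<in> A"
  shows "(\<Sum>H\<in>P. indicator H i) = (1 :: 'a :: semiring_1)"
proof -
  obtain H where H: "H \<in> P" "i \<in> H" using assms by (auto simp: partition_on_def)
  have "finite P" using assms by (metis finite_elements)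
  have "(\<Sum>H'\<in>P. indicator H' i) = (\<Sum>H'\<in>P. if H' = H then 1 else (0 :: 'a))"
    using partition_onD2[OF assms(1)] H by (intro sum.cong) (auto simp: disjoint_def indicator_def)
  also have "\<dots> = 1" using H \<open>finite P\<close> by simp
  finally show ?thesis .
qed

section \<open>The path of cdfs and the payoff along it\<close>

locale mixture_path =
  fixes a b cm :: real and T :: "(real \<Rightarrow> real) \<Rightarrow> real" and H1 H2 :: "real \<Rightarrow> real"
  assumes H1: "H1 \<in> Dcdf a b" and H2: "H2 \<in> Dcdf a b"
    and path: "\<tau> \<in> {0..1} \<Longrightarrow> (\<lambda>x. \<tau> * H1 x + (1 - \<tau>) * H2 x) \<in> Dcdf a b"
    and cm: "0 < cm"
    and growth: "0 \<le> \<tau>1 \<Longrightarrow> \<tau>1 \<le> \<tau>2 \<Longrightarrow> \<tau>2 \<le> 1 \<Longrightarrow>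
      cm * (\<tau>2 - \<tau>1) \<le> T (\<lambda>x. \<tau>2 * H1 x + (1 - \<tau>2) * H2 x) - T (\<lambda>x. \<tau>1 * H1 x + (1 - \<tau>1) * H2 x)"
begin

definition J :: "real \<Rightarrow> real \<Rightarrow> real" where
  "J \<tau> = (\<lambda>x. \<tau> * H1 x + (1 - \<tau>) * H2 x)"

text \<open>Clamping to the unit interval makes the payoff monotone, hence Borel, on the whole line.\<close>
definition payoff :: "real \<Rightarrow> real" where
  "payoff s = T (J (min 1 (max 0 s)))"

lemma J_Dcdf: "0 \<le> \<tau> \<Longrightarrow> \<tau> \<le> 1 \<Longrightarrow> J \<tau> \<in> Dcdf a b"
  using path[of \<tau>] by (simp add: J_def)

lemma payoff_growth:
  "0 \<le> s \<Longrightarrow> s \<le> t \<Longrightarrow> t \<le> 1 \<Longrightarrow> cm * (t - s) \<le> payoff t - payoff s"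
  using growth[of s t] by (simp add: payoff_def J_def)

lemma mono_payoff: "mono payoff"
proof
  fix s t :: real assume "s \<le> t"
  then have *: "0 \<le> min 1 (max 0 s)" "min 1 (max 0 s) \<le> min 1 (max 0 t)" "min 1 (max 0 t) \<le> 1" by auto
  have "0 \<le> cm * (min 1 (max 0 t) - min 1 (max 0 s))" using * cm by simp
  also have "\<dots> \<le> payoff t - payoff s" using growth[OF *] by (simp add: payoff_def J_def)
  finally show "payoff s \<le> payoff t" by simp
qed

lemma payoff_measurable[measurable]: "payoff \<in> borel_measurable borel"
  by (rule borel_measurable_mono[OF mono_payoff])

text \<open>The path is affine in its parameter, so mixtures of its cdfs stay on it. This reduces
  the functional to a monotone function of one real number.\<close>

lemma T_mix:
  assumes \<delta>: "\<delta> \<in> unit_simplex K" and \<tau>: "\<And>i. i \<in> {1..K} \<Longrightarrow> 0 \<le> \<tau> i \<and> \<tau> i \<le> 1"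
    and F: "\<And>i. i \<in> {1..K} \<Longrightarrow> F i = J (\<tau> i)"
  shows "T (mix K \<delta> F) = payoff (ip K \<tau> \<delta>)"
proof -
  have s: "(\<Sum>i=1..K. \<delta> i) = 1" using \<delta> by (auto simp: unit_simplex_def)
  have "mix K \<delta> F x = J (ip K \<tau> \<delta>) x" for x
  proof -
    have "mix K \<delta> F x = (\<Sum>i=1..K. \<tau> i * \<delta> i * H1 x + (\<delta> i - \<tau> i * \<delta> i) * H2 x)"
      unfolding mix_def by (intro sum.cong) (auto simp: F J_def algebra_simps)
    also have "\<dots> = J (ip K \<tau> \<delta>) x"
      by (simp add: sum.distrib sum_subtractf s J_def ip_def flip: sum_distrib_right)
    finally show ?thesis .
  qed
  then have "mix K \<delta> F = J (ip K \<tau> \<delta>)" by auto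
  then show ?thesis using ip_bounds[OF \<delta> \<tau>] by (simp add: payoff_def)
qed

text \<open>Both measures mix the laws of \<open>H1\<close> and \<open>H2\<close>, so a bound for
  the ratios of the two weights carries over to the ratio of the masses of any Borel set.\<close>

lemma ex_mixture_density:
  assumes \<tau>: "1/3 \<le> \<tau>" "\<tau> \<le> 2/3" and \<tau>': "0 \<le> \<tau>'" "\<tau>' \<le> 1" "\<bar>\<tau>' - \<tau>\<bar> \<le> e" and e: "3 * e \<le> 1"
  obtains \<rho> :: "real \<Rightarrow> real" where "\<rho> \<in> borel_measurable borel"
    "\<And>x. 1 - 3 * e \<le> \<rho> x" "\<And>x. \<rho> x \<le> 1 + 3 * e"
    "interval_measure (J \<tau>') = density (interval_measure (J \<tau>)) (\<lambda>x. ennreal (\<rho> x))"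
proof -
  have \<tau>01: "0 \<le> \<tau>" "\<tau> \<le> 1" using \<tau> by auto
  have e0: "0 \<le> e" using \<tau>' by auto
  interpret J0: real_distribution "interval_measure (J \<tau>)" by (rule Dcdf_real_distribution(1)[OF J_Dcdf[OF \<tau>01]])
  interpret J1: real_distribution "interval_measure (J \<tau>')" by (rule Dcdf_real_distribution(1)[OF J_Dcdf[OF \<tau>'(1,2)]])
  have em: "emeasure (interval_measure (J t)) A
      = ennreal t * emeasure (interval_measure H1) A + ennreal (1 - t) * emeasure (interval_measure H2) A"
    if "0 \<le> t" "t \<le> 1" "A \<in> sets borel" for t A
    unfolding J_def using that by (intro emeasure_interval_measure_mixture[OF H1 H2 path]) auto
  \<comment> \<open>The range [1/3, 2/3] enters here: an absolute change by \<open>e\<close> is at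
    most \<open>3 * e\<close> times either weight.\<close>
  have "e * 1 \<le> e * (3 * \<tau>)" "e * 1 \<le> e * (3 * (1 - \<tau>))" using e0 \<tau> by (intro mult_left_mono; simp)+
  then have bds: "(1 - 3 * e) * \<tau> \<le> \<tau>'" "\<tau>' \<le> (1 + 3 * e) * \<tau>"
      "(1 - 3 * e) * (1 - \<tau>) \<le> 1 - \<tau>'" "1 - \<tau>' \<le> (1 + 3 * e) * (1 - \<tau>)"
    using \<tau>'(3) by (auto simp: algebra_simps abs_le_iff)
  show thesis
  proof (rule ex_density_between[of "interval_measure (J \<tau>)" "interval_measure (J \<tau>')" "1 - 3 * e" "1 + 3 * e"])
    fix A assume "A \<in> sets (interval_measure (J \<tau>))"
    then have A: "A \<in> sets borel" by simp
    show "ennreal (1 - 3 * e) * emeasure (interval_measure (J \<tau>)) A \<le> emeasure (interval_measure (J \<tau>')) A"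
      unfolding em[OF \<tau>01 A] em[OF \<tau>'(1,2) A] distrib_left mult.assoc[symmetric]
      using e e0 \<tau>01 bds by (intro add_mono mult_right_mono) (auto simp flip: ennreal_mult intro!: ennreal_leI)
    show "emeasure (interval_measure (J \<tau>')) A \<le> ennreal (1 + 3 * e) * emeasure (interval_measure (J \<tau>)) A"
      unfolding em[OF \<tau>01 A] em[OF \<tau>'(1,2) A] distrib_left mult.assoc[symmetric]
      using e e0 \<tau>01 bds by (intro add_mono mult_right_mono) (auto simp flip: ennreal_mult intro!: ennreal_leI simp del: ennreal_plus)
  next
    fix \<rho> :: "real \<Rightarrow> real"
    assume "\<rho> \<in> borel_measurable (interval_measure (J \<tau>))" "\<And>x. 1 - 3 * e \<le> \<rho> x" "\<And>x. \<rho> x \<le> 1 + 3 * e"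
      "interval_measure (J \<tau>') = density (interval_measure (J \<tau>)) (\<lambda>x. ennreal (\<rho> x))"
    then show thesis by (intro that[of \<rho>]) auto
  qed (use e e0 J0.finite_measure_axioms J1.finite_measure_axioms in auto)
qed

end

section \<open>Expected regret of a policy in environments on the path\<close>

locale mixture_bandit = mixture_path a b cm T H1 H2 + bandit K n p PG
  for a b cm T H1 H2 K n p PG +
  fixes M :: "(nat \<Rightarrow> real) set" and r :: "(nat \<Rightarrow> real \<times> real) \<Rightarrow> real \<Rightarrow> (nat \<Rightarrow> real)"
  assumes M: "M \<subseteq> unit_simplex K" "M \<noteq> {}"
    and r: "(\<lambda>(h, g). r h g) \<in> histories n \<Otimes>\<^sub>M borel \<rightarrow>\<^sub>M restrict_space borel M"
begin

text \<open>Indices outside \<open>{1..K}\<close> get a dummy law so that every \<open>arm_law \<tau> i\<close> is a probability measure.\<close>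
definition arm_law :: "(nat \<Rightarrow> real) \<Rightarrow> nat \<Rightarrow> real measure" where
  "arm_law \<tau> i = interval_measure (J (if i \<in> {1..K} then \<tau> i else 0))"

text \<open>\<open>restrict\<close> places the family in the extensional function space over which
  the theorem takes its supremum.\<close>

definition cdfs :: "(nat \<Rightarrow> real) \<Rightarrow> nat \<Rightarrow> real \<Rightarrow> real" where
  "cdfs \<tau> = restrict (\<lambda>i. J (\<tau> i)) {1..K}"

definition admissible :: "(nat \<Rightarrow> real) \<Rightarrow> bool" where
  "admissible \<tau> \<longleftrightarrow> (\<forall>i\<in>{1..K}. 0 \<le> \<tau> i \<and> \<tau> i \<le> 1)"

definition best :: "(nat \<Rightarrow> real) \<Rightarrow> real" where
  "best \<tau> = (SUP \<delta>\<in>M. payoff (ip K \<tau> \<delta>))"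

lemma bandit_environment_arm_law:
  assumes "admissible \<tau>" shows "bandit_environment K n p PG (arm_law \<tau>)"
proof (intro bandit_environment.intro bandit_axioms bandit_environment_axioms.intro)
  fix i
  have "real_distribution (arm_law \<tau> i)"
    using assms by (auto simp: arm_law_def admissible_def intro!: Dcdf_real_distribution(1) J_Dcdf)
  then show "prob_space (arm_law \<tau> i)" by (simp add: real_distribution_def)
  show "sets (arm_law \<tau> i) = sets borel" by (simp add: arm_law_def)
qed

lemma payoff_ip_bounds:
  assumes "admissible \<tau>" "d \<in> M" shows "payoff 0 \<le> payoff (ip K \<tau> d)" "payoff (ip K \<tau> d) \<le> payoff 1"
  using ip_bounds[of d K 0 \<tau> 1] assms M by (auto simp: admissible_def intro!: monoD[OF mono_payoff])

lemma payoff_le_best: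
  assumes "admissible \<tau>" "d \<in> M" shows "payoff (ip K \<tau> d) \<le> best \<tau>"
  unfolding best_def using payoff_ip_bounds(2)[OF assms(1)] assms(2) by (intro cSUP_upper bdd_aboveI2) auto

lemma best_le:
  assumes "admissible \<tau>" shows "best \<tau> \<le> payoff 1"
  unfolding best_def using payoff_ip_bounds(2)[OF assms] M by (intro cSUP_least) auto

lemma r_in_M: "h \<in> space (histories n) \<Longrightarrow> r h g \<in> M"
  using measurable_space[OF r, of "(h, g)"] by (auto simp: space_pair_measure space_restrict_space)

text \<open>The first part passes from a Bochner integral over the sample space to a nonnegative
  integral over histories, the form in which the testing bound is stated. The uniform bound in the
  third part makes the real supremum over environments meaningful.\<close>

lemma exp_regret_eq:
  assumes \<tau>: "admissible \<tau>"
  shows "ennreal (exp_regret T K M (cdfs \<tau>) PG n p r)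
    = (\<integral>\<^sup>+h. \<integral>\<^sup>+g. ennreal (best \<tau> - payoff (ip K \<tau> (r h g))) \<partial>PG \<partial>bandit_environment.law K p PG (arm_law \<tau>) n)"
    and "0 \<le> exp_regret T K M (cdfs \<tau>) PG n p r"
    and "exp_regret T K M (cdfs \<tau>) PG n p r \<le> payoff 1 - payoff 0"
proof -
  interpret bandit_environment K n p PG "arm_law \<tau>" by (rule bandit_environment_arm_law[OF \<tau>])
  let ?\<Omega> = "PiM {1..n} (\<lambda>_. outcomes (arm_law \<tau>)) \<Otimes>\<^sub>M PiM {1..Suc n} (\<lambda>_. PG)"
  let ?X = "\<lambda>d. best \<tau> - payoff (ip K \<tau> d)"
  let ?rec = "\<lambda>\<omega>. r (hist p (fst \<omega>) (snd \<omega>) n) (snd \<omega> (Suc n))"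
  have rb[measurable]: "(\<lambda>x. r (fst x) (snd x)) \<in> histories n \<Otimes>\<^sub>M borel \<rightarrow>\<^sub>M borel"
    using r by (auto simp: measurable_restrict_space2_iff split_beta')
  interpret \<Omega>: prob_space ?\<Omega>
    by (intro prob_space_pair prob_space_PiM_outcomes prob_space_PiM_PG)
  \<comment> \<open>The two families of laws agree on \<open>{1..K}\<close>, which is all that the
    product sees.\<close>
  have outc: "outcomes (\<lambda>i. interval_measure (cdfs \<tau> i)) = outcomes (arm_law \<tau>)"
    by (intro PiM_cong) (auto simp: arm_law_def cdfs_def)
  have \<Omega>: "sample_space K (cdfs \<tau>) PG n = ?\<Omega>" by (simp add: sample_space_def outc)
  have hm: "(\<lambda>\<omega>. hist p (fst \<omega>) (snd \<omega>) n) \<in> ?\<Omega> \<rightarrow>\<^sub>M histories n"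
    using hist_measurable[of n "{1..n}" "{1..Suc n}" "arm_law \<tau>"] by (auto simp: sets_\<nu> split_beta')
  have gm: "(\<lambda>\<omega>. snd \<omega> (Suc n)) \<in> ?\<Omega> \<rightarrow>\<^sub>M borel"
  proof -
    have "(\<lambda>\<omega>. snd \<omega> (Suc n)) \<in> ?\<Omega> \<rightarrow>\<^sub>M PG" by measurable
    then show ?thesis using sets_PG measurable_cong_sets by blast
  qed
  have recm[measurable]: "?rec \<in> borel_measurable ?\<Omega>"
    using measurable_compose[OF measurable_Pair[OF hm gm] rb] by simp
  have recM: "?rec \<omega> \<in> M" if "\<omega> \<in> space ?\<Omega>" for \<omega>
    using measurable_space[OF hm that] by (rule r_in_M)
  have sup: "(SUP \<delta>\<in>M. T (mix K \<delta> (cdfs \<tau>))) = best \<tau>"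
    unfolding best_def using \<tau> M by (intro SUP_cong refl T_mix) (auto simp: cdfs_def admissible_def)
  have reg: "exp_regret T K M (cdfs \<tau>) PG n p r = (\<integral>\<omega>. ?X (?rec \<omega>) \<partial>?\<Omega>)"
    unfolding exp_regret_def \<Omega> sup
  proof (intro Bochner_Integration.integral_cong refl)
    fix \<omega> assume "\<omega> \<in> space ?\<Omega>"
    then have "?rec \<omega> \<in> unit_simplex K" by (intro subsetD[OF M(1)] recM)
    then have "T (mix K (?rec \<omega>) (cdfs \<tau>)) = payoff (ip K \<tau> (?rec \<omega>))"
      using \<tau> by (intro T_mix) (auto simp: cdfs_def admissible_def)
    then show "best \<tau> - T (mix K (?rec \<omega>) (cdfs \<tau>)) = ?X (?rec \<omega>)" by simp
  qed
  have X: "0 \<le> ?X d" "?X d \<le> payoff 1 - payoff 0" if "d \<in> M" for d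
    using payoff_le_best[OF \<tau> that] best_le[OF \<tau>] payoff_ip_bounds[OF \<tau> that] by auto
  have Xm: "(\<lambda>\<omega>. ?X (?rec \<omega>)) \<in> borel_measurable ?\<Omega>" by measurable
  have int: "integrable ?\<Omega> (\<lambda>\<omega>. ?X (?rec \<omega>))"
    using X[OF recM] by (intro \<Omega>.integrable_const_bound[of _ "payoff 1 - payoff 0"] Xm AE_I2) auto
  show nonneg: "0 \<le> exp_regret T K M (cdfs \<tau>) PG n p r"
    unfolding reg by (intro integral_nonneg_AE AE_I2 X recM)
  have "(\<integral>\<omega>. ?X (?rec \<omega>) \<partial>?\<Omega>) \<le> (\<integral>\<omega>. payoff 1 - payoff 0 \<partial>?\<Omega>)"
    by (intro integral_mono int X recM) auto
  then show "exp_regret T K M (cdfs \<tau>) PG n p r \<le> payoff 1 - payoff 0"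
    unfolding reg by (simp add: \<Omega>.prob_space)
  have "ennreal (exp_regret T K M (cdfs \<tau>) PG n p r) = (\<integral>\<^sup>+\<omega>. ennreal (?X (?rec \<omega>)) \<partial>?\<Omega>)"
    unfolding reg by (intro nn_integral_eq_integral[symmetric] int AE_I2 X recM)
  also have "\<dots> = (\<integral>\<^sup>+h. \<integral>\<^sup>+g. ennreal (?X (r h g)) \<partial>PG \<partial>law n)"
    using nn_integral_hist_randomization[of n "\<lambda>x. ennreal (?X (r (fst x) (snd x)))"] by simp
  finally show "ennreal (exp_regret T K M (cdfs \<tau>) PG n p r) = \<dots>" .
qed

lemma recommendation_measurable:
  assumes "A \<in> sets borel"
  shows "(\<lambda>x. indicator A (r (fst x) (snd x)) :: ennreal) \<in> borel_measurable (histories n \<Otimes>\<^sub>M borel)"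
  using assms r by (intro measurable_compose[OF _ borel_measurable_indicator])
    (auto simp: measurable_restrict_space2_iff split_beta')

lemma recommendation_section_measurable:
  assumes "h \<in> space (histories n)" "A \<in> sets borel"
  shows "(\<lambda>g. indicator A (r h g) :: ennreal) \<in> borel_measurable PG"
  using measurable_compose[OF measurable_Pair[OF measurable_const[OF assms(1)] measurable_ident_sets[OF sets_PG]]
      recommendation_measurable[OF assms(2)]] by simp

text \<open>Markov's inequality for the regret, with the event described by the
  recommendation.\<close>

lemma exp_regret_ge:
  assumes \<tau>: "admissible \<tau>" and A: "A \<in> sets borel" and "0 \<le> \<beta>"
    and \<beta>: "\<And>d. d \<in> M \<Longrightarrow> d \<in> A \<Longrightarrow> \<beta> \<le> best \<tau> - payoff (ip K \<tau> d)"
  shows "ennreal \<beta> * (\<integral>\<^sup>+h. \<integral>\<^sup>+g. indicator A (r h g) \<partial>PG \<partial>bandit_environment.law K p PG (arm_law \<tau>) n)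
    \<le> ennreal (exp_regret T K M (cdfs \<tau>) PG n p r)"
proof -
  interpret bandit_environment K n p PG "arm_law \<tau>" by (rule bandit_environment_arm_law[OF \<tau>])
  interpret PG: prob_space PG by (rule PG)
  note recommendation_measurable[OF A, measurable]
  have "ennreal \<beta> * (\<integral>\<^sup>+h. \<integral>\<^sup>+g. indicator A (r h g) \<partial>PG \<partial>law n)
      = (\<integral>\<^sup>+h. ennreal \<beta> * (\<integral>\<^sup>+g. indicator A (r h g) \<partial>PG) \<partial>law n)"
    by (rule nn_integral_cmult[symmetric]) measurable
  also have "\<dots> = (\<integral>\<^sup>+h. \<integral>\<^sup>+g. ennreal \<beta> * indicator A (r h g) \<partial>PG \<partial>law n)"
    by (intro nn_integral_cong nn_integral_cmult[symmetric] recommendation_section_measurable A) simp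
  also have "\<dots> \<le> (\<integral>\<^sup>+h. \<integral>\<^sup>+g. ennreal (best \<tau> - payoff (ip K \<tau> (r h g))) \<partial>PG \<partial>law n)"
    using \<beta> by (intro nn_integral_mono) (auto simp: r_in_M split: split_indicator intro!: ennreal_leI)
  also have "\<dots> = ennreal (exp_regret T K M (cdfs \<tau>) PG n p r)" by (rule exp_regret_eq(1)[OF \<tau>, symmetric])
  finally show ?thesis .
qed

text \<open>Growth along the path turns a gap of the linear payoff into a gap of \<open>T\<close> at
  rate \<open>cm\<close>, and \<open>e\<close> is the scale of the parameter. To reach the supremum,
  each competitor of \<open>d\<close> is compared with one number that does not depend on the
  competitor.\<close>

lemma payoff_gap_ge:
  assumes e: "0 < e" and u: "\<And>i. i \<in> {1..K} \<Longrightarrow> 0 \<le> 1/2 + e * u i \<and> 1/2 + e * u i \<le> 1" and d: "d \<in> M"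
  shows "cm * e * ((SUP \<delta>\<in>M. ip K u \<delta>) - ip K u d)
    \<le> best (\<lambda>i. 1/2 + e * u i) - payoff (ip K (\<lambda>i. 1/2 + e * u i) d)"
proof -
  let ?\<tau> = "\<lambda>i. 1/2 + e * u i"
  let ?gap = "best ?\<tau> - payoff (ip K ?\<tau> d)"
  have \<tau>: "admissible ?\<tau>" using u by (simp add: admissible_def)
  have ipe: "ip K ?\<tau> \<delta> = 1/2 + e * ip K u \<delta>" if "\<delta> \<in> M" for \<delta>
    using that M by (intro ip_affine) auto
  define gap where "gap = ?gap"
  have "ip K u \<delta> \<le> ip K u d + gap / (cm * e)" if \<delta>: "\<delta> \<in> M" for \<delta>
  \<comment> \<open>\<open>payoff_growth\<close> covers the competitors at least as good as
    \<open>d\<close>; for the others it suffices that the gap is nonnegative.\<close>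
  proof (cases "ip K u d \<le> ip K u \<delta>")
    case True
    have "cm * e * (ip K u \<delta> - ip K u d) = cm * (ip K ?\<tau> \<delta> - ip K ?\<tau> d)"
      unfolding ipe[OF d] ipe[OF \<delta>] by (simp add: algebra_simps)
    also have "\<dots> \<le> payoff (ip K ?\<tau> \<delta>) - payoff (ip K ?\<tau> d)"
    proof (rule payoff_growth)
      show "0 \<le> ip K ?\<tau> d" "ip K ?\<tau> \<delta> \<le> 1"
        using ip_bounds[of _ K 0 ?\<tau> 1] u d \<delta> M by blast+
      show "ip K ?\<tau> d \<le> ip K ?\<tau> \<delta>" using True e unfolding ipe[OF d] ipe[OF \<delta>] by simp
    qed
    also have "\<dots> \<le> gap" using payoff_le_best[OF \<tau> \<delta>] by (simp add: gap_def)
    finally show ?thesis using cm e by (simp add: field_simps)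
  next
    case False
    have "0 \<le> gap" using payoff_le_best[OF \<tau> d] by (simp add: gap_def)
    then have "0 \<le> gap / (cm * e)" using cm e by simp
    then show ?thesis using False by linarith
  qed
  then have "(SUP \<delta>\<in>M. ip K u \<delta>) \<le> ip K u d + gap / (cm * e)" using M by (intro cSUP_least) auto
  then have "cm * e * ((SUP \<delta>\<in>M. ip K u \<delta>) - ip K u d) \<le> gap" using cm e by (simp add: field_simps)
  then show ?thesis by (simp only: gap_def)
qed

text \<open>Pigeonhole in expectation: each round pulls exactly one block, so the expected pulls sum
  to \<open>n\<close> and the smallest is at most the average. Multiplying by the number of blocks
  avoids a division in \<open>ennreal\<close>.\<close>

lemma least_sampled_block:
  assumes \<tau>: "admissible \<tau>" and P: "partition_on {1..K} P" and K: "1 \<le> K"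
  obtains H where "H \<in> P"
    "of_nat (card P) * (\<integral>\<^sup>+h. (\<Sum>t\<in>{1..n}. indicator H (act t h)) \<partial>bandit_environment.law K p PG (arm_law \<tau>) n) \<le> (of_nat n :: ennreal)"
proof -
  interpret E: bandit_environment K n p PG "arm_law \<tau>" by (rule bandit_environment_arm_law[OF \<tau>])
  interpret L: prob_space "E.law n" by (rule E.prob_space_law) simp
  let ?N = "\<lambda>H. \<integral>\<^sup>+h. (\<Sum>t\<in>{1..n}. indicator H (act t h)) \<partial>E.law n"
  have fin: "finite P" and ne: "P \<noteq> {}"
    using finite_elements[OF _ P] P K by (auto simp: partition_on_def)
  have "(\<Sum>H\<in>P. ?N H) = (\<integral>\<^sup>+h. (\<Sum>H\<in>P. \<Sum>t\<in>{1..n}. indicator H (act t h)) \<partial>E.law n)"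
    by (rule nn_integral_sum[symmetric]) (intro borel_measurable_sum E.indicator_act_measurable)
  also have "\<dots> = (\<integral>\<^sup>+h. of_nat n \<partial>E.law n)"
  proof (intro nn_integral_cong)
    fix h assume h: "h \<in> space (E.law n)"
    have "(\<Sum>H\<in>P. \<Sum>t\<in>{1..n}. indicator H (act t h)) = (\<Sum>t\<in>{1..n}. \<Sum>H\<in>P. indicator H (act t h) :: ennreal)"
      by (rule sum.swap)
    also have "\<dots> = (\<Sum>t\<in>{1..n}. 1)"
      by (intro sum.cong refl sum_indicator_partition[OF P] E.act_range h) auto
    finally show "(\<Sum>H\<in>P. \<Sum>t\<in>{1..n}. indicator H (act t h)) = (of_nat n :: ennreal)" by simp
  qed
  also have "\<dots> = of_nat n" using L.emeasure_space_1 by (simp del: E.space_law)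
  finally have total: "(\<Sum>H\<in>P. ?N H) = of_nat n" .
  obtain H where H: "H \<in> P" "\<forall>H'\<in>P. ?N H \<le> ?N H'"
    using ex_min_if_finite[of "?N ` P"] fin ne by (auto simp: not_less)
  have "of_nat (card P) * ?N H \<le> (\<Sum>H\<in>P. ?N H)"
    using H(2) by (intro sum_bounded_below) auto
  then show thesis using that[OF H(1)] total by simp
qed

text \<open>A number \<open>gap\<close> that bounds the loss of each recommendation separately keeps
  suprema over \<open>S\<close> and its complement out of the argument. With \<open>e\<close> at
  most 1/16, the base parameters lie in [1/3, 2/3] and the shifted ones in [0, 1].\<close>

lemma two_point_bound:
  assumes e: "0 < e" "e \<le> 1/16"
    and v: "\<And>i. i \<in> {1..K} \<Longrightarrow> \<bar>v i\<bar> \<le> 1" and w: "\<And>i. i \<in> H \<Longrightarrow> \<bar>w i\<bar> \<le> 1"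
    and S: "S \<in> sets borel" and gap: "0 \<le> gap"
    and gap0: "\<And>d. d \<in> M \<Longrightarrow> d \<in> S \<Longrightarrow> gap \<le> (SUP \<delta>\<in>M. ip K v \<delta>) - ip K v d"
    and gap1: "\<And>d. d \<in> M \<Longrightarrow> d \<notin> S \<Longrightarrow> gap \<le> (SUP \<delta>\<in>M. ip K (\<lambda>j. v j + embed_block H w j) \<delta>)
          - ip K (\<lambda>j. v j + embed_block H w j) d"
    and pulls: "ennreal (18 * e\<^sup>2) * (\<integral>\<^sup>+h. (\<Sum>t\<in>{1..n}. indicator H (act t h))
      \<partial>bandit_environment.law K p PG (arm_law (\<lambda>i. 1/2 + e * v i)) n) \<le> ennreal (1/4)"
  shows "cm * e * gap / 2 \<le> exp_regret T K M (cdfs (\<lambda>i. 1/2 + e * v i)) PG n p r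
    + exp_regret T K M (cdfs (\<lambda>i. 1/2 + e * (v i + embed_block H w i))) PG n p r"
proof -
  let ?u = "\<lambda>i. v i + embed_block H w i"
  let ?\<tau>0 = "\<lambda>i. 1/2 + e * v i" and ?\<tau>1 = "\<lambda>i. 1/2 + e * (v i + embed_block H w i)"
  let ?R0 = "exp_regret T K M (cdfs ?\<tau>0) PG n p r" and ?R1 = "exp_regret T K M (cdfs ?\<tau>1) PG n p r"
  have ew: "\<bar>embed_block H w i\<bar> \<le> 1" for i using w by (auto simp: embed_block_def)
  have scale: "\<bar>e * x\<bar> \<le> c / 16" if "\<bar>x\<bar> \<le> c" "0 \<le> c" for x c
  proof -
    have "\<bar>e * x\<bar> \<le> 1/16 * c" unfolding abs_mult using e that by (intro mult_mono) auto
    then show ?thesis by simp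
  qed
  have ev: "\<bar>e * v i\<bar> \<le> 1/16" if "i \<in> {1..K}" for i using scale[OF v[OF that]] by simp
  have "\<bar>?u i\<bar> \<le> 2" if "i \<in> {1..K}" for i using v[OF that] ew[of i] by linarith
  then have eu: "\<bar>e * ?u i\<bar> \<le> 1/8" if "i \<in> {1..K}" for i using scale[of "?u i" 2] that by simp
  have r0: "1/3 \<le> ?\<tau>0 i \<and> ?\<tau>0 i \<le> 2/3" if "i \<in> {1..K}" for i using ev[OF that] by (auto simp: abs_le_iff)
  have r1: "0 \<le> ?\<tau>1 i \<and> ?\<tau>1 i \<le> 1" if "i \<in> {1..K}" for i using eu[OF that] unfolding abs_le_iff by linarith
  have \<tau>0: "admissible ?\<tau>0" unfolding admissible_def using r0 by fastforce
  have \<tau>1: "admissible ?\<tau>1" unfolding admissible_def using r1 by blast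
  \<comment> \<open>One density per index, so that \<open>choice\<close> can select all of them at
    once; off the block and off \<open>{1..K}\<close> the constant 1 is taken.\<close>
  have "\<forall>i. \<exists>\<rho>. \<rho> \<in> borel_measurable borel \<and> (\<forall>x. 1 - 3 * e \<le> \<rho> x \<and> \<rho> x \<le> 1 + 3 * e)
      \<and> (i \<in> {1..K} \<longrightarrow> arm_law ?\<tau>1 i = density (arm_law ?\<tau>0 i) (\<lambda>y. ennreal (\<rho> y)))
      \<and> (i \<notin> H \<longrightarrow> (\<forall>y. \<rho> y = 1))" (is "\<forall>i. \<exists>\<rho>. ?dens i \<rho>")
  proof
    fix i
    show "\<exists>\<rho>. ?dens i \<rho>"
    proof (cases "i \<in> H \<and> i \<in> {1..K}")
    case True
    have "\<bar>?\<tau>1 i - ?\<tau>0 i\<bar> = e * \<bar>embed_block H w i\<bar>"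
      using e by (simp add: distrib_left abs_mult)
    also have "\<dots> \<le> e" using mult_left_mono[OF ew[of i], of e] e by simp
    finally have diff: "\<bar>?\<tau>1 i - ?\<tau>0 i\<bar> \<le> e" .
    have \<tau>: "1/3 \<le> ?\<tau>0 i" "?\<tau>0 i \<le> 2/3" "0 \<le> ?\<tau>1 i" "?\<tau>1 i \<le> 1"
      using r0 r1 True by blast+
    have e3: "3 * e \<le> 1" using e by simp
    show ?thesis
    proof (rule ex_mixture_density[OF \<tau> diff e3])
      fix \<rho> :: "real \<Rightarrow> real"
      assume "\<rho> \<in> borel_measurable borel" "\<And>x. 1 - 3 * e \<le> \<rho> x" "\<And>x. \<rho> x \<le> 1 + 3 * e"
        "interval_measure (J (?\<tau>1 i)) = density (interval_measure (J (?\<tau>0 i))) (\<lambda>x. ennreal (\<rho> x))"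
      then show ?thesis using True by (intro exI[of _ \<rho>]) (simp add: arm_law_def)
    qed
  next
    case False
    have "arm_law ?\<tau>1 i = arm_law ?\<tau>0 i" if "i \<in> {1..K}"
      using False that by (simp add: arm_law_def embed_block_def)
    then show ?thesis using e by (intro exI[of _ "\<lambda>_. 1"]) (auto simp: density_1)
  qed
  qed
  from choice[OF this] obtain \<rho> where \<rho>: "\<forall>i. ?dens i (\<rho> i)" by blast
  interpret E0: bandit_environment K n p PG "arm_law ?\<tau>0" by (rule bandit_environment_arm_law[OF \<tau>0])
  interpret E1: bandit_environment K n p PG "arm_law ?\<tau>1" by (rule bandit_environment_arm_law[OF \<tau>1])
  interpret BC: bandit_change K n p PG "arm_law ?\<tau>0" "arm_law ?\<tau>1" \<rho> H "3 * e"
  proof (intro bandit_change.intro bandit_change_axioms.intro E0.bandit_environment_axioms E1.bandit_environment_axioms)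
    show "0 \<le> 3 * e" "3 * e \<le> 1/2" using e by auto
    fix i y
    show "\<rho> i \<in> borel_measurable borel" "1 - 3 * e \<le> \<rho> i y" "\<rho> i y \<le> 1 + 3 * e"
      "i \<in> {1..K} \<Longrightarrow> arm_law ?\<tau>1 i = density (arm_law ?\<tau>0 i) (\<lambda>y. ennreal (\<rho> i y))"
      "i \<notin> H \<Longrightarrow> \<rho> i y = 1"
      using spec[OF \<rho>, of i] by blast+
  qed
  interpret PG: prob_space PG by (rule PG)
  have S': "- S \<in> sets borel" using S by auto
  \<comment> \<open>The test is the conditional probability, given the history, of a recommendation
    in \<open>S\<close>: the final randomization is averaged out.\<close>
  let ?p0 = "\<integral>\<^sup>+h. \<integral>\<^sup>+g. indicator S (r h g) \<partial>PG \<partial>E0.law n"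
  let ?p1 = "\<integral>\<^sup>+h. \<integral>\<^sup>+g. indicator (- S) (r h g) \<partial>PG \<partial>E1.law n"
  have m: "(\<lambda>h. \<integral>\<^sup>+g. indicator A (r h g) \<partial>PG) \<in> borel_measurable (histories n)" if "A \<in> sets borel" for A
  proof -
    note recommendation_measurable[OF that, measurable]
    show ?thesis by measurable
  qed
  have p: "ennreal (1/2) \<le> ?p0 + ?p1"
  proof (rule BC.testing_error_ge[OF _ m[OF S] m[OF S']])
    show "ennreal (2 * (3 * e)\<^sup>2) * (\<integral>\<^sup>+h. (\<Sum>t\<in>{1..n}. indicator H (act t h)) \<partial>E0.law n) \<le> ennreal (1/4)"
      using pulls by (simp add: power_mult_distrib)
    fix h assume h: "h \<in> space (histories n)"
    have "(\<integral>\<^sup>+g. indicator S (r h g) \<partial>PG) + (\<integral>\<^sup>+g. indicator (- S) (r h g) \<partial>PG)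
        = (\<integral>\<^sup>+g. indicator S (r h g) + indicator (- S) (r h g) \<partial>PG)"
      by (rule nn_integral_add[symmetric]) (intro recommendation_section_measurable h S S')+
    also have "\<dots> = (\<integral>\<^sup>+g. 1 \<partial>PG)" by (intro nn_integral_cong) (auto split: split_indicator)
    finally show "(\<integral>\<^sup>+g. indicator S (r h g) \<partial>PG) + (\<integral>\<^sup>+g. indicator (- S) (r h g) \<partial>PG) = 1"
      by (simp add: PG.emeasure_space_1)
  qed
  have \<beta>: "0 \<le> cm * e * gap" using cm e gap by simp
  have le: "cm * e * gap \<le> cm * e * x" if "gap \<le> x" for x
    using that cm e by (intro mult_left_mono) auto
  have R0: "ennreal (cm * e * gap) * ?p0 \<le> ennreal ?R0"
  proof (rule exp_regret_ge[OF \<tau>0 S \<beta>])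
    fix d assume d: "d \<in> M" "d \<in> S"
    have "cm * e * ((SUP \<delta>\<in>M. ip K v \<delta>) - ip K v d) \<le> best ?\<tau>0 - payoff (ip K ?\<tau>0 d)"
      by (rule payoff_gap_ge) (use e d \<tau>0 in \<open>auto simp: admissible_def\<close>)
    with le[OF gap0[OF d]] show "cm * e * gap \<le> best ?\<tau>0 - payoff (ip K ?\<tau>0 d)" by (rule order_trans)
  qed
  have R1: "ennreal (cm * e * gap) * ?p1 \<le> ennreal ?R1"
  proof (rule exp_regret_ge[OF \<tau>1 S' \<beta>])
    fix d assume d: "d \<in> M" "d \<in> - S"
    have "cm * e * ((SUP \<delta>\<in>M. ip K ?u \<delta>) - ip K ?u d) \<le> best ?\<tau>1 - payoff (ip K ?\<tau>1 d)"
      by (rule payoff_gap_ge) (use e d \<tau>1 in \<open>auto simp: admissible_def\<close>)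
    with le[OF gap1] d show "cm * e * gap \<le> best ?\<tau>1 - payoff (ip K ?\<tau>1 d)" by force
  qed
  have "ennreal (cm * e * gap / 2) = ennreal (cm * e * gap) * ennreal (1/2)"
    using \<beta> by (subst ennreal_mult[symmetric]) auto
  also have "\<dots> \<le> ennreal (cm * e * gap) * (?p0 + ?p1)" by (rule mult_left_mono[OF p]) simp
  also have "\<dots> \<le> ennreal ?R0 + ennreal ?R1" using add_mono[OF R0 R1] by (simp add: distrib_left)
  also have "\<dots> = ennreal (?R0 + ?R1)" using exp_regret_eq(2)[OF \<tau>0] exp_regret_eq(2)[OF \<tau>1] by simp
  finally show ?thesis
    using exp_regret_eq(2)[OF \<tau>0] exp_regret_eq(2)[OF \<tau>1] by (subst (asm) ennreal_le_iff) auto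
qed

lemma cdfs_mem: "admissible \<tau> \<Longrightarrow> cdfs \<tau> \<in> {1..K} \<rightarrow>\<^sub>E J ` {0..1}"
  by (auto simp: cdfs_def admissible_def)

text \<open>\<open>cSUP_upper\<close> asks for a bound over all environments. It comes from
  \<open>exp_regret_eq(3)\<close> once every family in the function space is recognized as some
  \<open>cdfs \<tau>\<close>.\<close>

lemma exp_regret_le_SUP:
  assumes "admissible \<tau>"
  shows "exp_regret T K M (cdfs \<tau>) PG n p r \<le> (SUP F\<in>{1..K} \<rightarrow>\<^sub>E J ` {0..1}. exp_regret T K M F PG n p r)"
proof (intro cSUP_upper cdfs_mem assms bdd_aboveI2)
  fix F assume F: "F \<in> {1..K} \<rightarrow>\<^sub>E J ` {0..1}"
  then have "\<forall>i\<in>{1..K}. \<exists>t\<in>{0..1}. F i = J t" by (auto simp: PiE_def Pi_def)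
  then obtain \<tau> where \<tau>: "\<And>i. i \<in> {1..K} \<Longrightarrow> \<tau> i \<in> {0..1} \<and> F i = J (\<tau> i)" by metis
  then have "F = cdfs \<tau>" using F by (auto simp: cdfs_def restrict_def PiE_def extensional_def fun_eq_iff)
  moreover have "admissible \<tau>" using \<tau> by (auto simp: admissible_def)
  ultimately show "exp_regret T K M F PG n p r \<le> payoff 1 - payoff 0" using exp_regret_eq(3) by simp
qed

section \<open>From the two-point bound to kappa and to all partitions\<close>

lemma kappa_term_le:
  assumes K: "1 \<le> K" "K \<le> n" and P: "partition_on {1..K} P"
    and S: "S \<in> sets borel" "S \<noteq> {}" "S \<subset> M"
    and v: "\<forall>i\<in>{1..K}. \<bar>v i\<bar> \<le> 1" and w: "\<forall>H\<in>P. \<forall>j\<in>H. \<bar>w H j\<bar> \<le> 1"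
  shows "cm / 64 * sqrt (real (card P) / real n) *
      min ((SUP \<delta>\<in>M. ip K v \<delta>) - (SUP \<delta>\<in>S. ip K v \<delta>))
          (Min ((\<lambda>H. (SUP \<delta>\<in>M. ip K (\<lambda>j. v j + embed_block H (w H) j) \<delta>)
                    - (SUP \<delta>\<in>M - S. ip K (\<lambda>j. v j + embed_block H (w H) j) \<delta>)) ` P))
    \<le> (SUP F\<in>{1..K} \<rightarrow>\<^sub>E J ` {0..1}. exp_regret T K M F PG n p r)"
    (is "_ * ?q * min ?gS (Min (?g ` P)) \<le> ?sup")
proof -
  \<comment> \<open>The scale balances two demands: the regret is proportional to \<open>e\<close>,
    while the divergence over \<open>n / card P\<close> pulls has to stay below 1/4.\<close>
  define e where "e = ?q / 16"
  let ?\<kappa> = "min ?gS (Min (?g ` P))"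
  have fin: "finite P" and ne: "P \<noteq> {}"
    using finite_elements[OF _ P] P K by (auto simp: partition_on_def)
  have cP: "0 < card P" using fin ne by (simp add: card_gt_0_iff)
  \<comment> \<open>Choosing a representative of each block is injective. Together with
    \<open>K \<le> n\<close> this gives \<open>e \<le> 1/16\<close>.\<close>
  have "card P \<le> K"
  proof -
    have "card P \<le> card {1..K}"
    proof (rule card_inj_on_le[where f="\<lambda>H. SOME i. i \<in> H"])
      have some: "(SOME i. i \<in> H) \<in> H" if "H \<in> P" for H
        using partition_onD3[OF P] that by (metis some_in_eq)
      show "inj_on (\<lambda>H. SOME i. i \<in> H) P"
        using some partition_onD2[OF P] by (intro inj_onI) (metis IntI disjointD empty_iff)
      show "(\<lambda>H. SOME i. i \<in> H) ` P \<subseteq> {1..K}" using some partition_onD1[OF P] by auto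
    qed simp
    then show ?thesis by simp
  qed
  then have "real (card P) / real n \<le> 1" using K by simp
  then have q: "0 < ?q" "?q \<le> 1" using cP K by auto
  then have e: "0 < e" "e \<le> 1/16" by (auto simp: e_def)
  have e2: "18 * e\<^sup>2 = 18 / 256 / real n * real (card P)" using cP K by (simp add: e_def power_divide)
  let ?\<tau>0 = "\<lambda>i. 1/2 + e * v i"
  have ev: "\<bar>e * v i\<bar> \<le> 1/16" if "i \<in> {1..K}" for i
  proof -
    have "\<bar>e * v i\<bar> \<le> 1/16 * 1" unfolding abs_mult using e v that by (intro mult_mono) auto
    then show ?thesis by simp
  qed
  have \<tau>0: "admissible ?\<tau>0" unfolding admissible_def using ev by (fastforce simp: abs_le_iff)
  have sup0: "0 \<le> ?sup" using exp_regret_eq(2)[OF \<tau>0] exp_regret_le_SUP[OF \<tau>0] by linarith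
  show ?thesis
  \<comment> \<open>The two-point bound presupposes a nonnegative gap. A negative term lies below
    the supremum anyway, since regret is nonnegative.\<close>
  proof (cases "0 \<le> ?\<kappa>")
    case False
    then have "cm / 64 * ?q * ?\<kappa> \<le> 0" using cm q by (intro mult_nonneg_nonpos) auto
    then show ?thesis using sup0 by linarith
  next
    case True
    obtain H where H: "H \<in> P" and few: "of_nat (card P) * (\<integral>\<^sup>+h. (\<Sum>t\<in>{1..n}. indicator H (act t h))
        \<partial>bandit_environment.law K p PG (arm_law ?\<tau>0) n) \<le> (of_nat n :: ennreal)"
      using least_sampled_block[OF \<tau>0 P K(1)] by metis
    let ?N = "\<integral>\<^sup>+h. (\<Sum>t\<in>{1..n}. indicator H (act t h)) \<partial>bandit_environment.law K p PG (arm_law ?\<tau>0) n"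
    let ?u = "\<lambda>j. v j + embed_block H (w H) j"
    have HK: "H \<subseteq> {1..K}" using partition_onD1[OF P] H by auto
    have pulls: "ennreal (18 * e\<^sup>2) * ?N \<le> ennreal (1/4)"
    proof -
      have "ennreal (18 * e\<^sup>2) * ?N = ennreal (18 / 256 / real n) * (of_nat (card P) * ?N)"
        unfolding e2 by (subst ennreal_mult) (auto simp: ennreal_of_nat_eq_real_of_nat mult.assoc)
      also have "\<dots> \<le> ennreal (18 / 256 / real n) * of_nat n" by (rule mult_left_mono[OF few]) simp
      also have "\<dots> = ennreal (18 / 256)" using K by (simp add: ennreal_of_nat_eq_real_of_nat flip: ennreal_mult)
      also have "\<dots> \<le> ennreal (1/4)" by (rule ennreal_leI) simp
      finally show ?thesis .
    qed
    have bdd: "bdd_above (ip K x ` A)" if "A \<subseteq> M" "\<And>i. i \<in> {1..K} \<Longrightarrow> \<bar>x i\<bar> \<le> 2" for x A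
    proof (rule bdd_aboveI2)
      fix d assume "d \<in> A"
      then show "ip K x d \<le> 2"
        using ip_bounds(2)[of d K "-2" x 2] that M by (force simp: abs_le_iff)
    qed
    have v2: "\<bar>v i\<bar> \<le> 2" if "i \<in> {1..K}" for i using v that by force
    have ew: "\<bar>embed_block H (w H) i\<bar> \<le> 1" for i using w H by (auto simp: embed_block_def)
    have u2: "\<bar>?u i\<bar> \<le> 2" if "i \<in> {1..K}" for i using v[rule_format, OF that] ew[of i] by linarith
    have "cm * e * ?\<kappa> / 2 \<le> exp_regret T K M (cdfs ?\<tau>0) PG n p r
        + exp_regret T K M (cdfs (\<lambda>i. 1/2 + e * ?u i)) PG n p r"
    proof (rule two_point_bound[OF e _ _ S(1) True _ _ pulls])
      fix d assume d: "d \<in> M" "d \<in> S"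
      have "ip K v d \<le> (SUP \<delta>\<in>S. ip K v \<delta>)" using d S v2 by (intro cSUP_upper bdd) auto
      then show "?\<kappa> \<le> (SUP \<delta>\<in>M. ip K v \<delta>) - ip K v d" by linarith
    next
      fix d assume d: "d \<in> M" "d \<notin> S"
      have "ip K ?u d \<le> (SUP \<delta>\<in>M - S. ip K ?u \<delta>)" using d u2 by (intro cSUP_upper bdd) auto
      moreover have "?\<kappa> \<le> ?g H" using fin H by (intro min.coboundedI2 Min_le) auto
      ultimately show "?\<kappa> \<le> (SUP \<delta>\<in>M. ip K ?u \<delta>) - ip K ?u d" by linarith
    qed (use v w H in auto)
    also have "\<dots> \<le> ?sup + ?sup"
    proof (intro add_mono exp_regret_le_SUP \<tau>0)
      have "0 \<le> 1/2 + e * ?u i \<and> 1/2 + e * ?u i \<le> 1" if "i \<in> {1..K}" for i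
      proof -
        have "\<bar>e * ?u i\<bar> \<le> 1/16 * 2" unfolding abs_mult using e u2[OF that] by (intro mult_mono) auto
        then show ?thesis unfolding abs_le_iff by linarith
      qed
      then show "admissible (\<lambda>i. 1/2 + e * ?u i)" by (simp add: admissible_def)
    qed
    \<comment> \<open>Both regrets are at most the supremum, which is therefore at least a quarter
      of \<open>cm * e * ?\<kappa>\<close>; the factor 1/16 of \<open>e\<close> makes this
      1/64.\<close>
    finally show ?thesis by (simp add: e_def field_simps)
  qed
qed

text \<open>Division by the positive factor carries the bound for a single triple through the
  supremum in \<open>kappa\<close>.\<close>

lemma kappa_le:
  assumes K: "1 \<le> K" "K \<le> n" and P: "partition_on {1..K} P" and two: "d1 \<in> M" "d2 \<in> M" "d1 \<noteq> d2"
  shows "cm / 64 * (kappa K P M * sqrt (real (card P) / real n))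
    \<le> (SUP F\<in>{1..K} \<rightarrow>\<^sub>E J ` {0..1}. exp_regret T K M F PG n p r)"
    (is "_ \<le> ?sup")
proof -
  let ?q = "sqrt (real (card P) / real n)"
  have "finite P" "P \<noteq> {}"
    using finite_elements[OF _ P] P K by (auto simp: partition_on_def)
  then have q: "0 < cm / 64 * ?q" using cm K by (simp add: card_gt_0_iff)
  have ne: "x \<in> A \<Longrightarrow> A \<noteq> {}" for x :: 'z and A by blast
  have "kappa K P M \<le> ?sup / (cm / 64 * ?q)"
    unfolding kappa_def
  proof (rule cSUP_least, goal_cases)
    case 1
    \<comment> \<open>\<open>cSUP_least\<close> needs an admissible triple. A singleton is a proper
      subset because \<open>M\<close> has a second element.\<close>
    have "({d1}, (\<lambda>_. 0 :: real), (\<lambda>_ _. 0)) \<in> {(S, v, w). S \<in> sets (borel :: (nat \<Rightarrow> real) measure) \<and> S \<noteq> {} \<and> S \<subset> M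
         \<and> (\<forall>i\<in>{1..K}. \<bar>v i\<bar> \<le> 1) \<and> (\<forall>H\<in>P. \<forall>j\<in>H. \<bar>w H j\<bar> \<le> (1::real))}"
      using two by auto
    from ne[OF this] show ?case .
  next
    case (2 x)
    obtain S v w where x: "x = (S, v, w)" by (cases x)
    have "cm / 64 * ?q * (case x of (S, v, w) \<Rightarrow> min ((SUP \<delta>\<in>M. ip K v \<delta>) - (SUP \<delta>\<in>S. ip K v \<delta>))
          (Min ((\<lambda>H. (SUP \<delta>\<in>M. ip K (\<lambda>j. v j + embed_block H (w H) j) \<delta>)
                    - (SUP \<delta>\<in>M - S. ip K (\<lambda>j. v j + embed_block H (w H) j) \<delta>)) ` P))) \<le> ?sup"
      using 2 unfolding x prod.case mem_Collect_eq by (elim conjE) (rule kappa_term_le[OF K P])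
    then show ?case unfolding pos_le_divide_eq[OF q] by (subst mult.commute)
  qed
  then have "kappa K P M * (cm / 64 * ?q) \<le> ?sup" unfolding pos_le_divide_eq[OF q] .
  then show ?thesis by (simp only: mult_ac)
qed

end

theorem theoremB2:
  fixes a b C cm :: real and T :: "(real \<Rightarrow> real) \<Rightarrow> real"
    and D :: "(real \<Rightarrow> real) set" and H1 H2 :: "real \<Rightarrow> real"
  assumes "a < b"
    and "D \<subseteq> Dcdf a b" and "D \<noteq> {}" and "fun_convex D"
    and "C > 0"
    and "\<forall>F\<in>D. \<forall>G\<in>Dcdf a b. \<bar>T F - T G\<bar> \<le> C * supnorm (\<lambda>x. F x - G x)"
    and "H1 \<in> D" and "H2 \<in> D"
    and "\<forall>\<tau>\<in>{0..1}. (\<lambda>x. \<tau> * H1 x + (1 - \<tau>) * H2 x) \<in> D"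
    and "cm > 0"
    and "\<forall>\<tau>1 \<tau>2. 0 \<le> \<tau>1 \<and> \<tau>1 \<le> \<tau>2 \<and> \<tau>2 \<le> 1 \<longrightarrow>
           T (\<lambda>x. \<tau>2 * H1 x + (1 - \<tau>2) * H2 x) - T (\<lambda>x. \<tau>1 * H1 x + (1 - \<tau>1) * H2 x) \<ge> cm * (\<tau>2 - \<tau>1)"
  shows "\<exists>c>0. \<forall>K M. 2 \<le> K \<and> M \<subseteq> unit_simplex K \<and> closed M \<and> (\<exists>\<delta>1\<in>M. \<exists>\<delta>2\<in>M. \<delta>1 \<noteq> \<delta>2) \<longrightarrow>
    (\<forall>n p r PG. K \<le> n \<and> is_policy K M n p r \<and> prob_space PG \<and> sets PG = sets borel \<longrightarrow>
      (SUP F\<in>({1..K} \<rightarrow>\<^sub>E ((\<lambda>\<tau>. (\<lambda>x. \<tau> * H1 x + (1 - \<tau>) * H2 x)) ` {0..1})).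
          exp_regret T K M F PG n p r)
      \<ge> c * Max ((\<lambda>P. kappa K P M * sqrt (real (card P) / real n)) ` {P. partition_on {1..K} P}))"
proof (intro exI[of _ "cm / 64"] conjI allI impI)
  \<comment> \<open>The factor 1/64 collects 1/16 from the scale \<open>e\<close>, 1/2 from the
    testing bound and 1/2 from averaging two regrets. It is fixed before \<open>K\<close>,
    \<open>n\<close> and \<open>M\<close>.\<close>
  show "0 < cm / 64" using \<open>cm > 0\<close> by simp
  fix K n :: nat and M p r and PG :: "real measure"
  assume KM: "2 \<le> K \<and> M \<subseteq> unit_simplex K \<and> closed M \<and> (\<exists>\<delta>1\<in>M. \<exists>\<delta>2\<in>M. \<delta>1 \<noteq> \<delta>2)"
    and pol: "K \<le> n \<and> is_policy K M n p r \<and> prob_space PG \<and> sets PG = sets borel"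
  then obtain d1 d2 where two: "d1 \<in> M" "d2 \<in> M" "d1 \<noteq> d2" by blast
  interpret mixture_path a b cm T H1 H2
  proof unfold_locales
    show "H1 \<in> Dcdf a b" "H2 \<in> Dcdf a b" "0 < cm" using assms(2,7,8,10) by auto
    show "(\<lambda>x. \<tau> * H1 x + (1 - \<tau>) * H2 x) \<in> Dcdf a b" if "\<tau> \<in> {0..1}" for \<tau>
      using assms(2) bspec[OF assms(9) that] by (rule subsetD)
    show "cm * (\<tau>2 - \<tau>1) \<le> T (\<lambda>x. \<tau>2 * H1 x + (1 - \<tau>2) * H2 x) - T (\<lambda>x. \<tau>1 * H1 x + (1 - \<tau>1) * H2 x)"
      if "0 \<le> \<tau>1" "\<tau>1 \<le> \<tau>2" "\<tau>2 \<le> 1" for \<tau>1 \<tau>2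
      using assms(11) that by blast
  qed
  interpret mixture_bandit a b cm T H1 H2 K n p PG M r
  proof (intro mixture_bandit.intro bandit.intro mixture_bandit_axioms.intro mixture_path_axioms)
    show "prob_space PG" "sets PG = sets borel" "M \<subseteq> unit_simplex K" "M \<noteq> {}"
      using KM pol by auto
    show "(\<lambda>(h, g). p t h g) \<in> PiM {1..t-1} (\<lambda>_. borel) \<Otimes>\<^sub>M borel \<rightarrow>\<^sub>M count_space {1..K}"
      if "t \<in> {1..n}" for t
      using pol that by (simp add: is_policy_def)
    show "(\<lambda>(h, g). r h g) \<in> PiM {1..n} (\<lambda>_. borel) \<Otimes>\<^sub>M borel \<rightarrow>\<^sub>M restrict_space borel M"
      using pol by (simp add: is_policy_def)
  qed
  let ?Ps = "{P. partition_on {1..K} P}"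
  let ?f = "\<lambda>P. kappa K P M * sqrt (real (card P) / real n)"
  \<comment> \<open>There are finitely many partitions, among them the one with a single block, so
    the maximum is attained at some \<open>P\<close> and the bound for this \<open>P\<close>
    suffices.\<close>
  have "?Ps \<subseteq> Pow (Pow {1..K})" by (auto simp: partition_on_def)
  then have "finite ?Ps" by (rule finite_subset) simp
  moreover have "{{1..K}} \<in> ?Ps" using KM by (auto intro!: partition_on_space)
  ultimately have "Max (?f ` ?Ps) \<in> ?f ` ?Ps" by (intro Max_in) auto
  then obtain P where P: "partition_on {1..K} P" and "Max (?f ` ?Ps) = ?f P" by auto
  then show "cm / 64 * Max (?f ` ?Ps)
      \<le> (SUP F\<in>({1..K} \<rightarrow>\<^sub>E ((\<lambda>\<tau>. (\<lambda>x. \<tau> * H1 x + (1 - \<tau>) * H2 x)) ` {0..1})). exp_regret T K M F PG n p r)"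
    using kappa_le[OF _ _ P two] KM pol unfolding J_def[abs_def] by simp
qed

end
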